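(* Let $\mathcal F=\{S_1,\ldots,S_m\}$, $2\le m<n+2$, be an S-family of spheres in $\mathbb R^n$. If there is an $\mathcal F$-Steiner arrangement, then any tight $\mathcal F$-kissing arrangement is Steiner.
   Context: Put $d:=n+2-m$. Two distinct spheres in $\mathbb R^n$ are called non-intersecting if their intersection is not a sphere of radius $r>0$, i.e. they are either disjoint or touch each other. Let $\mathcal F=\{S_1,\ldots,S_m\}$ be a family of $m$ arbitrary spheres in $\mathbb R^n$ (each $S_i$ can be a sphere of any radius or a hyperplane). A set $\mathcal C$ of spheres in $\mathbb R^n$ is an $\mathcal F$-kissing arrangement if (1) each sphere from $\mathcal C$ is tangent to all spheres from $\mathcal F$; (2) each sphere from $\mathcal C$ is tangent to at least one sphere from $\mathcal C$; (3) any two distinct spheres from $\mathcal C$ are non-intersecting. The family $\mathcal F$, $m\ge 2$, is an S-family if (1) $S_1$ and $S_2$ are non-intersecting spheres; (2) each $S_i$ with $i>2$ can intersect at most one $S_j$ with $j=1,2$; (3) there are non-empty $\mathcal F$-kissing arrangements and all of them are finite. $\operatorname{card}_{\mathcal F}$ denotes the maximum cardinality of $\mathcal F$-kissing arrangements. An $\mathcal F$-kissing arrangement $\mathcal C=\{C_1,\ldots,C_k\}$ is a $k$-clique if all spheres in $\mathcal C$ are mutually tangent. A sphere $C_{k+1}$ is adjacent to $\mathcal C$ if $C_{k+1}$ is tangent to all spheres of $\mathcal C$ and of $\mathcal F$. Steiner arrangements are defined for S-families $\mathcal F$ with $\operatorname{card}_{\mathcal F}\ge d+1$: an $\mathcal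 F$-kissing arrangement $\mathcal C$ is ($\mathcal F$-)Steiner if it contains a $(d-1)$-clique and for all $(d-1)$-cliques in $\mathcal C$ their adjacent spheres also lie in $\mathcal C$. Tight arrangements (for such $\mathcal F$) are defined by the following process. Let $\mathcal C_0$ be any $(d-1)$-clique; it has two adjacent spheres. Let $C_1$ be one of them; then $\mathcal C_1:=\mathcal C_0\cup \{C_1\}$ is a $d$-clique. Suppose that after $k$ steps we have an $\mathcal F$-kissing arrangement $\mathcal C_k$. The next step can be done only if there are a $(d-1)$-clique in $\mathcal C_k$ and a (new) sphere $C_{k+1}$ adjacent to it such that $\mathcal C_{k+1}:=\mathcal C_k\cup \{C_{k+1}\}$ is an $\mathcal F$-kissing arrangement. Denote by $t$ the maximum number of possible steps. Then $\mathcal C_t$ is called a tight $\mathcal F$-kissing arrangement.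
   Formalization: Spheres tangent to all of F (in arrangements, cliques, adjacency) must also have all of F on one closed side; with bare tangency the claim fails, e.g. for concentric spheres in R^3. A single such sphere counts as a 1-clique, the empty set as a 0-clique. *)

theory Defs
  imports "HOL-Analysis.Analysis"
begin

text \<open>
  The geometry is inversive: a ``sphere'' is a round sphere of positive radius or a hyperplane, and
  the value \<open>None\<close> stands for the point at infinity, which lies on every hyperplane.
  In particular distinct parallel hyperplanes touch each other (at infinity), and two lines of the
  plane that cross do not.
\<close>

definition hyperplane :: "(real^'n) set \<Rightarrow> bool" where
  "hyperplane S \<longleftrightarrow> (\<exists>a b. a \<noteq> 0 \<and> S = {x. a \<bullet> x = b})"

definition gsphere :: "(real^'n) set \<Rightarrow> bool" where
  "gsphere S \<longleftrightarrow> (\<exists>a r. r > 0 \<and> S = sphere a r) \<or> hyperplane S"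

definition ext :: "(real^'n) set \<Rightarrow> (real^'n) option set" where
  "ext S = Some ` S \<union> (if hyperplane S then {None} else {})"

definition tangent :: "(real^'n) set \<Rightarrow> (real^'n) set \<Rightarrow> bool" where
  "tangent S T \<longleftrightarrow> (\<exists>p. ext S \<inter> ext T = {p})"

definition nonintersecting :: "(real^'n) set \<Rightarrow> (real^'n) set \<Rightarrow> bool" where
  "nonintersecting S T \<longleftrightarrow> S \<noteq> T \<and> (ext S \<inter> ext T = {} \<or> tangent S T)"

text \<open>The two open sides of a sphere; replacing \<open>a, b\<close> by \<open>-a, -b\<close> gives the other half-space.\<close>

definition open_side :: "(real^'n) option set \<Rightarrow> (real^'n) set \<Rightarrow> bool" where
  "open_side U C \<longleftrightarrow>
     (\<exists>a r. r > 0 \<and> C = sphere a r \<and>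
        (U = Some ` ball a r \<or> U = insert None (Some ` (- cball a r)))) \<or>
     (\<exists>a b. a \<noteq> 0 \<and> C = {x. a \<bullet> x = b} \<and> U = Some ` {x. a \<bullet> x < b})"

text \<open>
  A sphere kissing a family is tangent to each member, with the whole family on one closed side.
  The side condition is what makes a clique of \<open>d - 1\<close> spheres have two adjacent ones: if the family
  consists of the concentric spheres of radii \<open>r < R\<close>, it selects the spheres of diameter \<open>R - r\<close>
  lying between them, and discards the spheres of diameter \<open>R + r\<close> that enclose the smaller sphere
  and touch both.
\<close>

definition kisses :: "(real^'n) set set \<Rightarrow> (real^'n) set \<Rightarrow> bool" where
  "kisses F C \<longleftrightarrow> gsphere C \<and> (\<forall>S\<in>F. tangent C S) \<and>
     (\<exists>U. open_side U C \<and> (\<forall>S\<in>F. ext S \<inter> U = {}))"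

definition kissing_arrangement :: "(real^'n) set set \<Rightarrow> (real^'n) set set \<Rightarrow> bool" where
  "kissing_arrangement F \<C> \<longleftrightarrow>
     (\<forall>C\<in>\<C>. kisses F C) \<and>
     (\<forall>C\<in>\<C>. \<exists>D\<in>\<C>. tangent C D) \<and>
     (\<forall>C\<in>\<C>. \<forall>D\<in>\<C>. C \<noteq> D \<longrightarrow> nonintersecting C D)"

definition S_family :: "nat \<Rightarrow> (nat \<Rightarrow> (real^'n) set) \<Rightarrow> bool" where
  "S_family m S \<longleftrightarrow>
     nonintersecting (S 1) (S 2) \<and>
     (\<forall>i\<in>{3..m}. nonintersecting (S i) (S 1) \<or> nonintersecting (S i) (S 2)) \<and>
     (\<exists>\<C>. \<C> \<noteq> {} \<and> kissing_arrangement (S ` {1..m}) \<C>) \<and>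
     (\<forall>\<C>. kissing_arrangement (S ` {1..m}) \<C> \<longrightarrow> finite \<C>)"

definition max_kissing_card :: "(real^'n) set set \<Rightarrow> nat" where
  "max_kissing_card F = Max {card \<C> |\<C>. kissing_arrangement F \<C>}"

text \<open>
  For \<open>k \<ge> 2\<close> a clique is automatically a kissing arrangement.  For \<open>k = 1\<close> it is a single kissing
  sphere, which has no tangent partner within the clique and so is not a kissing arrangement, but
  which is needed as the \<open>(d - 1)\<close>-clique when \<open>d = 2\<close> (the classical chains of Steiner and Soddy).
\<close>

definition clique :: "(real^'n) set set \<Rightarrow> nat \<Rightarrow> (real^'n) set set \<Rightarrow> bool" where
  "clique F k K \<longleftrightarrow> finite K \<and> card K = k \<and> (\<forall>C\<in>K. kisses F C) \<and>
     (\<forall>C\<in>K. \<forall>D\<in>K. C \<noteq> D \<longrightarrow> tangent C D)"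

definition adjacent :: "(real^'n) set set \<Rightarrow> (real^'n) set set \<Rightarrow> (real^'n) set \<Rightarrow> bool" where
  "adjacent F K X \<longleftrightarrow> kisses F X \<and> (\<forall>C\<in>K. tangent X C)"

definition steiner :: "nat \<Rightarrow> (real^'n) set set \<Rightarrow> (real^'n) set set \<Rightarrow> bool" where
  "steiner d F \<C> \<longleftrightarrow>
     max_kissing_card F \<ge> d + 1 \<and>
     kissing_arrangement F \<C> \<and>
     (\<exists>K\<subseteq>\<C>. clique F (d - 1) K) \<and>
     (\<forall>K\<subseteq>\<C>. clique F (d - 1) K \<longrightarrow> (\<forall>X. adjacent F K X \<longrightarrow> X \<in> \<C>))"

text \<open>\<open>tight_process d F \<C>\<^sub>0 k \<C>\<close>: the set \<open>\<C>\<close> can be reached from \<open>\<C>\<^sub>0\<close> in \<open>k \<ge> 1\<close> steps.\<close>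

inductive tight_process ::
    "nat \<Rightarrow> (real^'n) set set \<Rightarrow> (real^'n) set set \<Rightarrow> nat \<Rightarrow> (real^'n) set set \<Rightarrow> bool"
  for d F \<C>\<^sub>0 where
  first: "\<lbrakk>clique F (d - 1) \<C>\<^sub>0; adjacent F \<C>\<^sub>0 X\<rbrakk> \<Longrightarrow> tight_process d F \<C>\<^sub>0 1 (insert X \<C>\<^sub>0)"
| step: "\<lbrakk>tight_process d F \<C>\<^sub>0 k \<C>; K \<subseteq> \<C>; clique F (d - 1) K; adjacent F K X; X \<notin> \<C>;
     kissing_arrangement F (insert X \<C>)\<rbrakk> \<Longrightarrow> tight_process d F \<C>\<^sub>0 (k + 1) (insert X \<C>)"

definition tight :: "nat \<Rightarrow> (real^'n) set set \<Rightarrow> (real^'n) set set \<Rightarrow> bool" where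
  "tight d F \<C> \<longleftrightarrow>
     max_kissing_card F \<ge> d + 1 \<and>
     (\<exists>\<C>\<^sub>0 t. tight_process d F \<C>\<^sub>0 t \<C> \<and>
        (\<forall>k \<D>. tight_process d F \<C>\<^sub>0 k \<D> \<longrightarrow> k \<le> t))"

end

theory Submission
  imports Defs
begin

text \<open>
  An oriented sphere of \<open>\<real>\<^sup>n \<union> {\<infinity>}\<close> is a unit vector of the Minkowski space
  \<open>\<real>\<^sup>n\<^sup>+\<^sup>2\<close>, a point is a null ray of the future cone, and two distinct spheres touch iff the product of
  their vectors is \<open>\<plusminus>1\<close>.  A sphere kisses \<open>F\<close> iff some orientation \<open>c\<close> of it and suitable orientations
  \<open>s\<close> of the members of \<open>F\<close> satisfy \<open>\<langle>c, s\<rangle> = -1\<close> with \<open>c + s\<close> in the future cone.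

  The orientations of \<open>F\<close> may depend on the kissing sphere.  For an S-family, however, a kissing
  sphere whose orientations differ from those of the others touches no other kissing sphere, so it lies
  in no arrangement.  The exceptions are parallel hyperplanes beyond \<open>S\<^sub>1\<close> and \<open>S\<^sub>2\<close>, when these two
  touch at infinity, and spheres squeezed between some \<open>S\<^sub>i\<close> and one of \<open>S\<^sub>1\<close>, \<open>S\<^sub>2\<close>.  All relevant spheres
  thus have their vectors in a single set \<open>\<Sigma>\<close> given by \<open>\<langle>c, s\<rangle> = -1\<close> for fixed \<open>s\<close>.

  Distinct \<open>x, y \<in> \<Sigma>\<close> have \<open>\<langle>x, y\<rangle> < 1\<close>, since \<open>x - y\<close> is orthogonal to the causal vector \<open>s\<^sub>1 + s\<^sub>2\<close>.  Hence
  the reflection in \<open>x - y\<close> exists, preserves \<open>\<Sigma>\<close> and swaps \<open>x\<close> and \<open>y\<close>; composing such reflections moves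
  any clique to any other of the same size.  So some image of the given Steiner arrangement contains
  the initial clique of the tight process, hence everything the process produces, and a process
  that can no longer continue has absorbed all adjacent spheres.

  For \<open>d = 1\<close> the cliques are empty and a Steiner arrangement consists of all kissing spheres.
  Three points of \<open>\<Sigma>\<close> would force \<open>\<Sigma>\<close> to be infinite, so there are only two kissing spheres; the case
  of two disjoint spheres on a line, which may be interlaced, is settled by hand.
\<close>

section \<open>The Minkowski model of sphere geometry\<close>

type_synonym 'n lvec = "(real^'n) \<times> real \<times> real"

text \<open>
  A vector \<open>(v, \<alpha>, \<beta>)\<close> has square norm \<open>v \<bullet> v - \<alpha> \<beta>\<close>.  The sphere with centre \<open>a\<close> and radius \<open>r\<close> is
  represented by \<open>\<plusminus>(a / r, 1 / r, (a \<bullet> a - r\<^sup>2) / r)\<close>, the hyperplane \<open>v \<bullet> x = b\<close> with \<open>v \<bullet> v = 1\<close> by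
  \<open>\<plusminus>(v, 0, 2 b)\<close>.
\<close>

definition mink :: "'n::finite lvec \<Rightarrow> 'n lvec \<Rightarrow> real" where
  "mink a b = fst a \<bullet> fst b - (fst (snd a) * snd (snd b) + fst (snd b) * snd (snd a)) / 2"

lemma mink_commute: "mink a b = mink b a"
  by (simp add: mink_def inner_commute)

lemma mink_add_left: "mink (a + b) c = mink a c + mink b c"
  by (simp add: mink_def inner_add_left algebra_simps add_divide_distrib)

lemma mink_scale_left: "mink (r *\<^sub>R a) c = r * mink a c"
  by (simp add: mink_def algebra_simps add_divide_distrib)

lemma mink_minus_left: "mink (- a) c = - mink a c"
  using mink_scale_left[of "-1" a c] by simp

lemma mink_diff_left: "mink (a - b) c = mink a c - mink b c"
  using mink_add_left[of a "- b" c] by (simp add: mink_minus_left)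

lemma mink_add_right: "mink c (a + b) = mink c a + mink c b"
  and mink_scale_right: "mink c (r *\<^sub>R a) = r * mink c a"
  and mink_minus_right: "mink c (- a) = - mink c a"
  and mink_diff_right: "mink c (a - b) = mink c a - mink c b"
  by (simp_all add: mink_commute[of c] mink_add_left mink_scale_left mink_minus_left mink_diff_left)

lemma mink_zero [simp]: "mink 0 a = 0" "mink a 0 = 0"
  by (simp_all add: mink_def)

lemmas mink_linear = mink_add_left mink_add_right mink_scale_left mink_scale_right
  mink_minus_left mink_minus_right mink_diff_left mink_diff_right

text \<open>Up to the factor -2 this is the product with the timelike vector
  \<open>(0, 1, 1)\<close>, so it serves as a time coordinate whose sign tells the two cones
  apart.\<close>

definition height :: "'n::finite lvec \<Rightarrow> real" where
  "height a = fst (snd a) + snd (snd a)"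

lemma height_linear: "height (a + b) = height a + height b" "height (- a) = - height a"
  "height (a - b) = height a - height b" "height (r *\<^sub>R a) = r * height a"
  by (simp_all add: height_def algebra_simps)

section \<open>Causal vectors and the reversed Cauchy-Schwarz inequality\<close>

definition causal :: "'n::finite lvec \<Rightarrow> bool" where
  "causal a \<longleftrightarrow> mink a a \<le> 0 \<and> height a > 0"

definition future_null :: "'n::finite lvec \<Rightarrow> bool" where
  "future_null a \<longleftrightarrow> mink a a = 0 \<and> height a > 0"

lemma future_nullD: "future_null a \<Longrightarrow> causal a"
  by (simp add: causal_def future_null_def)

lemma future_null_scale: "future_null a \<Longrightarrow> k > 0 \<Longrightarrow> future_null (k *\<^sub>R a)"
  by (simp add: future_null_def mink_linear height_linear)

lemma future_null_nonzero: "future_null a \<Longrightarrow> a \<noteq> 0"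
  by (auto simp: future_null_def height_def)

text \<open>At height zero the form becomes a sum of squares, so only the zero vector satisfies
  \<open>mink a a \<le> 0\<close> there.\<close>

lemma causal_cases:
  assumes "mink a a \<le> 0" "a \<noteq> 0"
  shows "causal a \<or> causal (- a)"
proof (rule ccontr)
  assume "\<not> ?thesis"
  then have "height a = 0"
    using assms by (auto simp: causal_def mink_linear height_linear)
  then have h: "snd (snd a) = - fst (snd a)"
    by (simp add: height_def)
  then have "fst a \<bullet> fst a + (fst (snd a))\<^sup>2 \<le> 0"
    using assms(1) by (simp add: mink_def power2_eq_square)
  moreover have "fst a \<bullet> fst a \<ge> 0" "(fst (snd a))\<^sup>2 \<ge> 0"
    by simp_all
  ultimately have "fst a \<bullet> fst a = 0" "(fst (snd a))\<^sup>2 = 0"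
    by linarith+
  then have "a = 0"
    using h by (simp add: prod_eq_iff)
  then show False
    using assms by simp
qed

lemma future_null_cases:
  assumes "mink a a = 0" "a \<noteq> 0"
  shows "future_null a \<or> future_null (- a)"
  using causal_cases[of a] assms by (auto simp: causal_def future_null_def mink_linear)

lemma causal_coords:
  assumes "causal (v, a, b)"
  shows "a \<ge> 0" "b \<ge> 0" "v \<bullet> v \<le> a * b" "a + b > 0"
proof -
  show ab: "v \<bullet> v \<le> a * b" "a + b > 0"
    using assms by (auto simp: causal_def mink_def height_def)
  have "0 \<le> a * b"
    using ab(1) inner_ge_zero[of v] by linarith
  then show "a \<ge> 0" "b \<ge> 0"
    using ab(2) by (auto simp: zero_le_mult_iff)
qed

text \<open>The reversed Cauchy-Schwarz inequality: the bounds
  \<open>v \<bullet> v \<le> a * b\<close> and \<open>w \<bullet> w \<le> c * d\<close> combine with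
  the inequality of arithmetic and geometric means, and equality throughout makes the vectors
  parallel.\<close>

lemma mink_future:
  assumes "causal p" "causal q"
  shows "mink p q \<le> 0" and "mink p q = 0 \<Longrightarrow> \<exists>k>0. p = k *\<^sub>R q"
proof -
  obtain v a b where p: "p = (v, a, b)" by (cases p)
  obtain w c d where q: "q = (w, c, d)" by (cases q)
  note P = causal_coords[OF assms(1)[unfolded p]]
  note Q = causal_coords[OF assms(2)[unfolded q]]
  have "(v \<bullet> w)\<^sup>2 \<le> (v \<bullet> v) * (w \<bullet> w)"
    by (rule Cauchy_Schwarz_ineq)
  also have "\<dots> \<le> (a * b) * (c * d)"
    using P Q by (intro mult_mono) auto
  also have "\<dots> \<le> ((a * d + c * b) / 2)\<^sup>2"
    using zero_le_power2[of "a * d - c * b"] by (simp add: power2_eq_square algebra_simps)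
  finally have sq: "(v \<bullet> w)\<^sup>2 \<le> ((a * d + c * b) / 2)\<^sup>2" .
  have "v \<bullet> w \<le> (a * d + c * b) / 2"
    using power2_le_imp_le[OF sq] P Q by simp
  then show le: "mink p q \<le> 0"
    by (simp add: p q mink_def)
  assume "mink p q = 0"
  then have vw: "v \<bullet> w = (a * d + c * b) / 2"
    by (simp add: p q mink_def)
  have "((a * d + c * b) / 2)\<^sup>2 \<le> (a * b) * (c * d)"
    using \<open>(v \<bullet> w)\<^sup>2 \<le> (v \<bullet> v) * (w \<bullet> w)\<close> \<open>(v \<bullet> v) * (w \<bullet> w) \<le> (a * b) * (c * d)\<close> vw by simp
  then have "(a * d - c * b)\<^sup>2 \<le> 0"
    by (simp add: power2_eq_square algebra_simps)
  then have eq: "a * d = c * b"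
    by simp
  have zero: "x = 0" if "x \<bullet> x \<le> 0" for x :: "real^'n"
    using that by (metis antisym inner_eq_zero_iff inner_ge_zero)
  \<comment> \<open>Applied to the coefficients \<open>a, c\<close> and then \<open>b, d\<close>: a
    single coordinate may be zero, but \<open>a + b\<close> and \<open>c + d\<close> are positive,
    so adding the two relations determines \<open>v\<close>.\<close>
  have *: "(x *\<^sub>R w - y *\<^sub>R v) \<bullet> (x *\<^sub>R w - y *\<^sub>R v) = x * x * (w \<bullet> w) + y * y * (v \<bullet> v) - 2 * (x * y) * (a * d)" for x y
    using vw eq by (simp add: inner_diff_left inner_diff_right inner_commute algebra_simps)
  have "(a *\<^sub>R w - c *\<^sub>R v) \<bullet> (a *\<^sub>R w - c *\<^sub>R v) \<le> a * a * (c * d) + c * c * (a * b) - 2 * (a * c) * (a * d)"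
    unfolding * using P Q by (intro diff_right_mono add_mono mult_left_mono) auto
  also have "\<dots> = a * c * (c * b - a * d)"
    by (simp add: algebra_simps)
  finally have ac: "a *\<^sub>R w = c *\<^sub>R v"
    using eq zero[of "a *\<^sub>R w - c *\<^sub>R v"] by simp
  have "(b *\<^sub>R w - d *\<^sub>R v) \<bullet> (b *\<^sub>R w - d *\<^sub>R v) \<le> b * b * (c * d) + d * d * (a * b) - 2 * (b * d) * (a * d)"
    unfolding * using P Q by (intro diff_right_mono add_mono mult_left_mono) auto
  also have "\<dots> = b * d * (c * b - a * d)"
    by (simp add: algebra_simps)
  finally have bd: "b *\<^sub>R w = d *\<^sub>R v"
    using eq zero[of "b *\<^sub>R w - d *\<^sub>R v"] by simp
  let ?k = "(a + b) / (c + d)"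
  have "(c + d) *\<^sub>R v = (a + b) *\<^sub>R w"
    using ac bd by (simp add: scaleR_add_left)
  moreover have "v = (1 / (c + d)) *\<^sub>R ((c + d) *\<^sub>R v)"
    using Q by simp
  ultimately have "v = ?k *\<^sub>R w"
    by simp
  moreover have "a = ?k * c" "b = ?k * d"
    using Q eq by (simp_all add: field_simps)
  ultimately have "p = ?k *\<^sub>R q"
    by (simp add: p q)
  moreover have "?k > 0"
    using P Q by simp
  ultimately show "\<exists>k>0. p = k *\<^sub>R q"
    by blast
qed

lemma causal_orthogonal:
  assumes "causal p" "mink w p = 0" "mink w w \<le> 0"
  shows "\<exists>k. w = k *\<^sub>R p"
proof (cases "w = 0")
  case True
  then show ?thesis by (intro exI[of _ 0]) simp
next
  case False
  then consider "causal w" | "causal (- w)"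
    using causal_cases assms by blast
  then show ?thesis
  proof cases
    case 1
    then show ?thesis using mink_future(2)[OF 1 assms(1) assms(2)] by blast
  next
    case 2
    then obtain k where "- w = k *\<^sub>R p"
      using mink_future(2)[OF 2 assms(1)] assms(2) by (auto simp: mink_linear)
    then have "w = (- k) *\<^sub>R p" by (metis minus_minus scaleR_minus_left)
    then show ?thesis by blast
  qed
qed

text \<open>The orthogonal complement of a timelike vector is positive definite: by
  \<open>causal_orthogonal\<close> a counterexample would be a multiple of \<open>h\<close>, which
  is not orthogonal to itself.\<close>

lemma timelike_orthogonal:
  assumes "mink h h < 0" "mink w h = 0" "mink w w \<le> 0"
  shows "w = 0"
proof -
  have "h \<noteq> 0" using assms by auto
  then consider "causal h" | "causal (- h)"
    using causal_cases[of h] assms(1) by auto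
  then obtain k where "w = k *\<^sub>R h"
  proof cases
    case 1
    then show ?thesis using causal_orthogonal[OF 1, of w] assms that by blast
  next
    case 2
    then obtain k where "w = k *\<^sub>R (- h)" using causal_orthogonal[OF 2, of w] assms by (auto simp: mink_linear)
    then have "w = (- k) *\<^sub>R h" by simp
    then show ?thesis by (rule that)
  qed
  then show ?thesis
    using assms by (simp add: mink_linear)
qed

section \<open>Points as null rays\<close>

fun pt :: "(real^'n) option \<Rightarrow> 'n lvec" where
  "pt (Some x) = (x, 1, x \<bullet> x)"
| "pt None = (0, 0, 1)"

lemma future_null_pt: "future_null (pt p)"
  by (cases p) (auto simp: future_null_def mink_def height_def add_pos_nonneg)

text \<open>Together with \<open>pt_eq_scale\<close> this identifies points, infinity included, with
  future null rays; the ray of infinity is the one with \<open>a = 0\<close>.\<close>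

lemma future_null_eq_scale_pt:
  assumes "future_null q"
  obtains k p where "k > 0" "q = k *\<^sub>R pt p"
proof -
  obtain v a b where q: "q = (v, a, b)" by (cases q)
  have vv: "v \<bullet> v = a * b"
    using assms by (simp add: q future_null_def mink_def)
  note P = causal_coords[OF future_nullD[OF assms, unfolded q]]
  show ?thesis
  proof (cases "a = 0")
    case True
    then have "q = b *\<^sub>R pt None" "b > 0"
      using vv P by (auto simp: q)
    then show ?thesis using that by blast
  next
    case False
    have "q = a *\<^sub>R pt (Some ((1 / a) *\<^sub>R v))"
      using False vv by (simp add: q)
    moreover have "a > 0" using False P by simp
    ultimately show ?thesis using that by blast
  qed
qed

lemma pt_eq_scale:
  assumes "pt p = k *\<^sub>R pt q"
  shows "p = q"
  using assms by (cases p; cases q) auto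

section \<open>Spheres as unit vectors, and their two sides\<close>

definition unit :: "'n::finite lvec \<Rightarrow> bool" where
  "unit u \<longleftrightarrow> mink u u = 1"

definition sphere_of :: "'n::finite lvec \<Rightarrow> (real^'n) set" where
  "sphere_of u = {x. mink (pt (Some x)) u = 0}"

lemma unit_minus [simp]: "unit (- u) \<longleftrightarrow> unit u"
  by (simp add: unit_def mink_linear)

lemma sphere_of_minus [simp]: "sphere_of (- u) = sphere_of u"
  by (simp add: sphere_of_def mink_linear)

text \<open>The product is a multiple of the power of the point \<open>x\<close>, and the sign of
  \<open>\<sigma>\<close> decides whether the inside or the outside is positive.\<close>

lemma mink_pt_sphere:
  assumes "\<sigma> \<noteq> 0"
  shows "mink (pt (Some x)) (\<sigma> *\<^sub>R a, \<sigma>, \<sigma> * (a \<bullet> a - r\<^sup>2)) = \<sigma> / 2 * (r\<^sup>2 - (dist a x)\<^sup>2)"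
  by (simp add: mink_def dist_norm power2_norm_eq_inner inner_diff_left inner_diff_right inner_commute
      field_simps)

lemma unit_sphere_vec: "r > 0 \<Longrightarrow> \<sigma> = 1 / r \<or> \<sigma> = - 1 / r \<Longrightarrow> unit (\<sigma> *\<^sub>R a, \<sigma>, \<sigma> * (a \<bullet> a - r\<^sup>2))"
  by (elim disjE; hypsubst; simp add: unit_def mink_def field_simps power2_eq_square)

lemma unit_cases:
  assumes "unit u"
  obtains (sphere) a r \<sigma> where "r > 0" "\<sigma> = 1 / r \<or> \<sigma> = - 1 / r" "u = (\<sigma> *\<^sub>R a, \<sigma>, \<sigma> * (a \<bullet> a - r\<^sup>2))" "sphere_of u = sphere a r"
  | (plane) v b where "v \<bullet> v = 1" "u = (v, 0, 2 * b)" "sphere_of u = {x. v \<bullet> x = b}"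
proof -
  obtain v \<alpha> \<beta> where u: "u = (v, \<alpha>, \<beta>)" by (cases u)
  have vv: "v \<bullet> v = 1 + \<alpha> * \<beta>"
    using assms by (simp add: u unit_def mink_def)
  show ?thesis
  proof (cases "\<alpha> = 0")
    case True
    have "sphere_of u = {x. v \<bullet> x = \<beta> / 2}"
      by (auto simp: sphere_of_def u mink_def True inner_commute)
    then show ?thesis
      using plane[of v "\<beta> / 2"] vv True u by simp
  next
    case False
    define r where "r = 1 / \<bar>\<alpha>\<bar>"
    define a where "a = (1 / \<alpha>) *\<^sub>R v"
    have r: "r > 0" using False by (simp add: r_def)
    have \<alpha>: "\<alpha> = 1 / r \<or> \<alpha> = - 1 / r" by (auto simp: r_def abs_if)
    have r2: "r\<^sup>2 = 1 / (\<alpha> * \<alpha>)" by (simp add: r_def power2_eq_square)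
    have "\<beta> = \<alpha> * (a \<bullet> a - r\<^sup>2)"
      using False vv by (simp add: a_def r2 field_simps)
    then have ueq: "u = (\<alpha> *\<^sub>R a, \<alpha>, \<alpha> * (a \<bullet> a - r\<^sup>2))"
      using False by (simp add: u a_def)
    have "sphere_of u = sphere a r"
      unfolding sphere_of_def ueq mink_pt_sphere[OF False] using False r
      by (auto simp: power2_eq_iff)
    then show ?thesis using sphere r \<alpha> ueq by blast
  qed
qed

text \<open>A hyperplane containing two antipodal points would contain the centre as their
  midpoint.\<close>

lemma sphere_not_hyperplane:
  fixes a :: "real^'n"
  assumes "r > 0"
  shows "\<not> hyperplane (sphere a r)"
proof
  assume "hyperplane (sphere a r)"
  then obtain v b where vb: "sphere a r = {x. v \<bullet> x = b}"
    by (auto simp: hyperplane_def)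
  obtain e :: "real^'n" where e: "norm e = r"
    using vector_choose_size[of r] assms by auto
  have "a + e \<in> sphere a r" "a - e \<in> sphere a r"
    using e by (auto simp: dist_norm)
  then have "v \<bullet> a = b"
    unfolding vb by (simp add: inner_add_right inner_diff_right)
  then have "a \<in> sphere a r"
    unfolding vb by simp
  then show False using assms by simp
qed

lemma ext_sphere_of:
  assumes "unit u"
  shows "ext (sphere_of u) = {p. mink (pt p) u = 0}"
  using assms
proof (cases rule: unit_cases)
  case (sphere a r \<sigma>)
  have s: "\<sigma> \<noteq> 0" using sphere by auto
  have "mink (pt None) u \<noteq> 0"
    using s by (simp add: sphere(3) mink_def)
  moreover have "\<not> hyperplane (sphere_of u)"
    using sphere sphere_not_hyperplane by metis
  ultimately show ?thesis
    unfolding set_eq_iff by (intro allI, rename_tac p, case_tac p) (auto simp: ext_def sphere_of_def)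
next
  case (plane v b)
  have "mink (pt None) u = 0"
    by (simp add: plane(2) mink_def)
  moreover have "hyperplane (sphere_of u)"
    unfolding hyperplane_def using plane by (metis inner_zero_left zero_neq_one)
  ultimately show ?thesis
    unfolding set_eq_iff by (intro allI, rename_tac p, case_tac p) (auto simp: ext_def sphere_of_def)
qed

lemma gsphere_iff: "gsphere C \<longleftrightarrow> (\<exists>u. unit u \<and> C = sphere_of u)"
proof
  assume "gsphere C"
  then consider a r where "r > 0" "C = sphere a r" | a b where "a \<noteq> 0" "C = {x. a \<bullet> x = b}"
    unfolding gsphere_def hyperplane_def by blast
  then show "\<exists>u. unit u \<and> C = sphere_of u"
  proof cases
    case 1
    let ?u = "((1 / r) *\<^sub>R a, 1 / r, 1 / r * (a \<bullet> a - r\<^sup>2))"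
    have "sphere_of ?u = sphere a r"
      unfolding sphere_of_def using 1 mink_pt_sphere[of "1 / r" _ a r] by (auto simp: power2_eq_iff)
    then show ?thesis using 1 unit_sphere_vec[of r "1 / r" a] by metis
  next
    case 2
    let ?u = "((1 / norm a) *\<^sub>R a, 0, 2 * (b / norm a))"
    have "sphere_of ?u = {x. a \<bullet> x = b}"
      using 2 by (auto simp: sphere_of_def mink_def inner_commute field_simps)
    moreover have "unit ?u"
      using 2 by (simp add: unit_def mink_def field_simps power2_norm_eq_inner[symmetric] power2_eq_square)
    ultimately show ?thesis using 2 by metis
  qed
next
  assume "\<exists>u. unit u \<and> C = sphere_of u"
  then obtain u where "unit u" "C = sphere_of u" by blast
  from this(1) show "gsphere C"
  proof (cases rule: unit_cases)
    case sphere then show ?thesis using \<open>C = sphere_of u\<close> by (auto simp: gsphere_def)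
  next
    case plane then show ?thesis using \<open>C = sphere_of u\<close>
      unfolding gsphere_def hyperplane_def by (metis inner_zero_left zero_neq_one)
  qed
qed

text \<open>The two sides correspond to the two orientations: \<open>\<sigma> = 1 / r\<close> makes
  the ball positive, \<open>\<sigma> = - 1 / r\<close> the exterior together with infinity.\<close>

lemma open_side_iff: "open_side U C \<longleftrightarrow> (\<exists>u. unit u \<and> C = sphere_of u \<and> U = {p. mink (pt p) u > 0})"
proof
  assume "open_side U C"
  then consider (ball) a r where "r > 0" "C = sphere a r" "U = Some ` ball a r"
    | (cball) a r where "r > 0" "C = sphere a r" "U = insert None (Some ` (- cball a r))"
    | (plane) a b where "a \<noteq> 0" "C = {x. a \<bullet> x = b}" "U = Some ` {x. a \<bullet> x < b}"
    unfolding open_side_def by blast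
  then show "\<exists>u. unit u \<and> C = sphere_of u \<and> U = {p. mink (pt p) u > 0}"
  proof cases
    case ball
    let ?s = "1 / r"
    let ?u = "(?s *\<^sub>R a, ?s, ?s * (a \<bullet> a - r\<^sup>2))"
    have s: "?s \<noteq> 0" using ball by simp
    have "sphere_of ?u = sphere a r"
      unfolding sphere_of_def mink_pt_sphere[OF s] using ball by (auto simp: power2_eq_iff)
    moreover have "Some ` ball a r = {p. mink (pt p) ?u > 0}"
    proof (intro set_eqI)
      fix p show "p \<in> Some ` ball a r \<longleftrightarrow> p \<in> {p. mink (pt p) ?u > 0}"
      proof (cases p)
        case None then show ?thesis using ball by (simp add: mink_def)
      next
        case (Some x)
        have "(dist a x)\<^sup>2 < r\<^sup>2 \<longleftrightarrow> dist a x < r"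
          using ball by (simp add: power_mono_iff less_le_not_le)
        then show ?thesis
          using ball unfolding Some mem_Collect_eq mink_pt_sphere[OF s]
          by (auto simp: zero_less_mult_iff zero_less_divide_iff)
      qed
    qed
    ultimately show ?thesis using ball unit_sphere_vec[of r ?s a] by (intro exI[of _ ?u]) simp
  next
    case cball
    let ?s = "- 1 / r"
    let ?u = "(?s *\<^sub>R a, ?s, ?s * (a \<bullet> a - r\<^sup>2))"
    have s: "?s \<noteq> 0" using cball by simp
    have "sphere_of ?u = sphere a r"
      unfolding sphere_of_def mink_pt_sphere[OF s] using cball by (auto simp: power2_eq_iff)
    moreover have "insert None (Some ` (- cball a r)) = {p. mink (pt p) ?u > 0}"
    proof (intro set_eqI)
      fix p show "p \<in> insert None (Some ` (- cball a r)) \<longleftrightarrow> p \<in> {p. mink (pt p) ?u > 0}"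
      proof (cases p)
        case None then show ?thesis using cball by (simp add: mink_def)
      next
        case (Some x)
        have "(dist a x)\<^sup>2 > r\<^sup>2 \<longleftrightarrow> dist a x > r"
          using cball by (simp add: power_mono_iff less_le_not_le)
        then show ?thesis
          using cball unfolding Some mem_Collect_eq mink_pt_sphere[OF s]
          by (auto simp: zero_less_mult_iff zero_less_divide_iff mult_less_0_iff divide_less_0_iff)
      qed
    qed
    ultimately show ?thesis using cball unit_sphere_vec[of r ?s a] by (intro exI[of _ ?u]) simp
  next
    case plane
    \<comment> \<open>The minus signs make the product positive where
      \<open>a \<bullet> x < b\<close>.\<close>
    let ?u = "(- (1 / norm a) *\<^sub>R a, 0, - 2 * (b / norm a))"
    have "sphere_of ?u = {x. a \<bullet> x = b}"
      using plane by (auto simp: sphere_of_def mink_def inner_commute field_simps)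
    moreover have "unit ?u"
      using plane by (simp add: unit_def mink_def field_simps power2_norm_eq_inner[symmetric] power2_eq_square)
    moreover have "Some ` {x. a \<bullet> x < b} = {p. mink (pt p) ?u > 0}"
    proof (intro set_eqI)
      fix p show "p \<in> Some ` {x. a \<bullet> x < b} \<longleftrightarrow> p \<in> {p. mink (pt p) ?u > 0}"
        using plane by (cases p) (auto simp: mink_def inner_commute field_simps)
    qed
    ultimately show ?thesis using plane by (intro exI[of _ ?u]) simp
  qed
next
  assume "\<exists>u. unit u \<and> C = sphere_of u \<and> U = {p. mink (pt p) u > 0}"
  then obtain u where u: "unit u" "C = sphere_of u" "U = {p. mink (pt p) u > 0}" by blast
  from this(1) show "open_side U C"
  proof (cases rule: unit_cases)
    case (sphere a r \<sigma>)
    have s: "\<sigma> \<noteq> 0" using sphere by auto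
    have iff: "(dist a x)\<^sup>2 < r\<^sup>2 \<longleftrightarrow> dist a x < r" "(dist a x)\<^sup>2 > r\<^sup>2 \<longleftrightarrow> dist a x > r" for x
      using sphere by (simp_all add: power_mono_iff less_le_not_le)
    have "U = Some ` ball a r \<or> U = insert None (Some ` (- cball a r))"
      using sphere(2)
    proof
      assume \<sigma>: "\<sigma> = 1 / r"
      have "p \<in> U \<longleftrightarrow> p \<in> Some ` ball a r" for p
      proof (cases p)
        case None then show ?thesis using sphere \<sigma> u by (simp add: mink_def)
      next
        case (Some x)
        then show ?thesis
          using sphere(1) iff[of x] unfolding u(3) sphere(3) Some mem_Collect_eq mink_pt_sphere[OF s]
          by (auto simp: \<sigma> zero_less_mult_iff zero_less_divide_iff)
      qed
      then show ?thesis by blast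
    next
      assume \<sigma>: "\<sigma> = - 1 / r"
      have "p \<in> U \<longleftrightarrow> p \<in> insert None (Some ` (- cball a r))" for p
      proof (cases p)
        case None then show ?thesis using sphere \<sigma> u by (simp add: mink_def)
      next
        case (Some x)
        then show ?thesis
          using sphere(1) iff[of x] unfolding u(3) sphere(3) Some mem_Collect_eq mink_pt_sphere[OF s]
          by (auto simp: \<sigma> zero_less_mult_iff zero_less_divide_iff mult_less_0_iff divide_less_0_iff)
      qed
      then show ?thesis by blast
    qed
    then show ?thesis using sphere u by (auto simp: open_side_def)
  next
    case (plane v b)
    have "p \<in> U \<longleftrightarrow> p \<in> Some ` {x. (- v) \<bullet> x < - b}" for p
      unfolding u(3) plane(2) by (cases p) (auto simp: mink_def inner_commute)
    moreover have "C = {x. (- v) \<bullet> x = - b}" "- v \<noteq> 0"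
      using u plane by auto
    ultimately show ?thesis
      unfolding open_side_def by blast
  qed
qed

section \<open>Tangency and kissing in the Minkowski model\<close>

text \<open>This holds even on the line, where a hyperplane consists of one finite point and
  infinity. It rules out self-tangency and, in \<open>kissesE\<close>, the wrong time
  direction.\<close>

lemma ext_sphere_of_two_points:
  fixes u :: "'n::finite lvec"
  assumes "unit u"
  obtains p q where "p \<in> ext (sphere_of u)" "q \<in> ext (sphere_of u)" "p \<noteq> q"
  using assms
proof (cases rule: unit_cases)
  case (sphere a r \<sigma>)
  obtain e :: "real^'n" where e: "norm e = r"
    using vector_choose_size[of r] sphere by auto
  have "a + e \<noteq> a - e"
  proof
    assume "a + e = a - e"
    then have "2 *\<^sub>R e = 0"
      by (simp add: scaleR_2 algebra_simps)
    then show False using e sphere by simp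
  qed
  moreover have "Some (a + e) \<in> ext (sphere_of u)" "Some (a - e) \<in> ext (sphere_of u)"
    using e by (auto simp: ext_def sphere(4) dist_norm)
  ultimately show ?thesis using that by blast
next
  case (plane v b)
  have "None \<in> ext (sphere_of u)"
    unfolding ext_sphere_of[OF assms] by (simp add: plane mink_def)
  moreover have "Some (b *\<^sub>R v) \<in> ext (sphere_of u)"
    by (auto simp: ext_def plane(1,3))
  ultimately show ?thesis using that by blast
qed

text \<open>For round spheres, comparing \<open>e\<close> with \<open>- e\<close> shows that all
  directions are orthogonal to \<open>b - a\<close>, so the centres agree. For hyperplanes, moving
  along the part \<open>y\<close> of \<open>v'\<close> orthogonal to \<open>v\<close> stays inside,
  which forces \<open>y = 0\<close>.\<close>

lemma sphere_of_eq_iff: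
  fixes u w :: "'n::finite lvec"
  assumes "unit u" "unit w"
  shows "sphere_of u = sphere_of w \<longleftrightarrow> w = u \<or> w = - u"
proof
  assume eq: "sphere_of u = sphere_of w"
  from assms(1) show "w = u \<or> w = - u"
  proof (cases rule: unit_cases)
    case (sphere a r \<sigma>)
    note u = this
    from assms(2) show ?thesis
    proof (cases rule: unit_cases)
      case (sphere b s \<tau>)
      have *: "(norm (b - a))\<^sup>2 + r\<^sup>2 - 2 * (e \<bullet> (b - a)) = s\<^sup>2" if "norm e = r" for e :: "real^'n"
      proof -
        have "a + e \<in> sphere b s"
          using that u(4) sphere(4) eq by (auto simp: dist_norm)
        then have "(norm (b - a - e))\<^sup>2 = s\<^sup>2"
          by (simp add: dist_norm algebra_simps)
        moreover have "e \<bullet> e = r\<^sup>2"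
          using that by (simp add: power2_norm_eq_inner[symmetric])
        ultimately show ?thesis
          by (simp add: power2_norm_eq_inner inner_diff_left inner_diff_right inner_commute)
      qed
      have orth: "e \<bullet> (b - a) = 0" if "norm e = r" for e :: "real^'n"
        using *[of e] *[of "- e"] that by simp
      have ba: "b = a"
      proof (rule ccontr)
        assume "b \<noteq> a"
        then have "((r / norm (b - a)) *\<^sub>R (b - a)) \<bullet> (b - a) \<noteq> 0"
          using u(1) by simp
        then show False
          using orth[of "(r / norm (b - a)) *\<^sub>R (b - a)"] u(1) \<open>b \<noteq> a\<close> by simp
      qed
      obtain e :: "real^'n" where e: "norm e = r"
        using vector_choose_size[of r] u by auto
      have "r\<^sup>2 = s\<^sup>2"
        using *[OF e] ba by simp
      then have "r = s"
        using u(1) sphere(1) by (simp add: power2_eq_iff)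
      then show ?thesis
        using u(2,3) sphere(2,3) ba by auto
    next
      case (plane v b)
      then show ?thesis
        using u eq sphere_not_hyperplane[OF u(1), of a] unfolding hyperplane_def
        by (metis inner_zero_left zero_neq_one)
    qed
  next
    case (plane v b)
    note u = this
    from assms(2) show ?thesis
    proof (cases rule: unit_cases)
      case (sphere a r \<sigma>)
      then show ?thesis
        using u eq sphere_not_hyperplane[OF sphere(1), of a] unfolding hyperplane_def
        by (metis inner_zero_left zero_neq_one)
    next
      case (plane v' b')
      have same: "v \<bullet> x = b \<longleftrightarrow> v' \<bullet> x = b'" for x
        using eq u(3) plane(3) by (auto simp: set_eq_iff)
      define k where "k = v \<bullet> v'"
      define y where "y = v' - k *\<^sub>R v"
      have vy: "v \<bullet> y = 0"
        using u(1) by (simp add: y_def k_def inner_diff_right)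
      have "v' \<bullet> (b *\<^sub>R v) = b'"
        using same[of "b *\<^sub>R v"] u(1) by simp
      moreover have "v' \<bullet> (b *\<^sub>R v + y) = b'"
        using same[of "b *\<^sub>R v + y"] u(1) vy by (simp add: inner_add_right)
      ultimately have "v' \<bullet> y = 0"
        by (simp add: inner_add_right)
      then have "y \<bullet> y = 0"
        using vy by (simp add: y_def inner_diff_left)
      then have v': "v' = k *\<^sub>R v"
        by (simp add: y_def)
      have "k * k = 1"
        using plane(1) u(1) by (simp add: v')
      then have "k = 1 \<or> k = - 1"
        by (simp add: square_eq_1_iff)
      moreover have "b' = k * b"
        using \<open>v' \<bullet> (b *\<^sub>R v) = b'\<close> u(1) by (simp add: v' mult.commute)
      ultimately show ?thesis
        using v' u(2) plane(2) by auto
    qed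
  qed
qed auto

text \<open>The vectors \<open>c\<close> and \<open>d\<close> span a positive definite plane, and
  projecting the timelike \<open>e\<close> off this plane can only decrease its square norm.\<close>

lemma timelike_orthogonal_exists:
  fixes c d :: "'n::finite lvec"
  assumes "unit c" "unit d" "\<bar>mink c d\<bar> < 1"
  obtains h where "mink h h < 0" "mink h c = 0" "mink h d = 0"
proof -
  define e :: "'n lvec" where "e = (0, 1, 1)"
  define g p q where "g = mink c d" and "p = mink e c" and "q = mink e d"
  \<comment> \<open>Cramer's rule for \<open>mink h c = 0\<close> and \<open>mink h d = 0\<close>,
    with Gram determinant \<open>1 - g\<^sup>2\<close>.\<close>
  define x y where "x = (p - g * q) / (1 - g\<^sup>2)" and "y = (q - g * p) / (1 - g\<^sup>2)"
  define h where "h = e - x *\<^sub>R c - y *\<^sub>R d"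
  have g: "1 - g\<^sup>2 > 0"
    using assms(3) by (simp add: g_def abs_square_less_1)
  have c: "mink c c = 1" "mink d d = 1" "mink d c = g" "mink c d = g"
    using assms by (simp_all add: unit_def g_def mink_commute)
  have "x + g * y = p * (1 - g\<^sup>2) / (1 - g\<^sup>2)" "g * x + y = q * (1 - g\<^sup>2) / (1 - g\<^sup>2)"
    by (simp_all add: x_def y_def add_divide_distrib[symmetric] algebra_simps power2_eq_square)
  then have xy: "p = x + g * y" "q = g * x + y"
    using g by simp_all
  have hc: "mink h c = 0" and hd: "mink h d = 0"
    by (simp_all add: h_def mink_linear c p_def[symmetric] q_def[symmetric]) (simp_all add: xy)
  have "mink h h = mink h e"
    using hc hd by (subst (2) h_def) (simp add: mink_linear)
  also have "\<dots> = - 1 - (x * p + y * q)"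
    by (simp add: h_def mink_linear p_def q_def mink_commute) (simp add: e_def mink_def)
  also have "x * p + y * q = ((p - g * q)\<^sup>2 + (1 - g\<^sup>2) * q\<^sup>2) / (1 - g\<^sup>2)"
    by (simp add: x_def y_def add_divide_distrib[symmetric]) (simp add: algebra_simps power2_eq_square)
  finally have "mink h h = - 1 - ((p - g * q)\<^sup>2 + (1 - g\<^sup>2) * q\<^sup>2) / (1 - g\<^sup>2)" .
  moreover have "((p - g * q)\<^sup>2 + (1 - g\<^sup>2) * q\<^sup>2) / (1 - g\<^sup>2) \<ge> 0"
    using g by simp
  ultimately have "mink h h < 0"
    by linarith
  then show ?thesis
    using hc hd that by blast
qed

text \<open>The reflection along a timelike \<open>h\<close> orthogonal to \<open>c\<close> and
  \<open>d\<close> keeps both spheres and moves every null ray, since no null ray is orthogonal to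
  \<open>h\<close>.\<close>

lemma common_point_not_unique:
  assumes "unit c" "unit d" "\<bar>mink c d\<bar> < 1" "p \<in> ext (sphere_of c) \<inter> ext (sphere_of d)"
  obtains p' where "p' \<in> ext (sphere_of c) \<inter> ext (sphere_of d)" "p' \<noteq> p"
proof -
  obtain h where h: "mink h h < 0" "mink h c = 0" "mink h d = 0"
    using timelike_orthogonal_exists assms by blast
  define q where "q = pt p"
  have q: "mink q c = 0" "mink q d = 0" "mink q q = 0" "q \<noteq> 0"
    using assms future_null_pt[of p] future_null_nonzero[OF future_null_pt[of p]] by (auto simp: ext_sphere_of q_def future_null_def)
  have qh: "mink q h \<noteq> 0"
    using timelike_orthogonal[OF h(1), of q] q by auto
  define q' where "q' = q - (2 * mink q h / mink h h) *\<^sub>R h"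
  have q'q: "mink q' q \<noteq> 0"
    using qh h(1) q by (simp add: q'_def mink_linear mink_commute[of h q])
  have q'0: "mink q' q' = 0" "mink q' c = 0" "mink q' d = 0"
    using h q by (auto simp: q'_def mink_linear mink_commute[of h q] field_simps)
  have "q' \<noteq> 0"
    using q'q by auto
  then obtain e where e: "e = 1 \<or> e = - 1" "future_null (e *\<^sub>R q')"
    using future_null_cases[OF q'0(1)] by (metis scaleR_minus1_left scaleR_one)
  obtain k p' where k: "k > 0" "e *\<^sub>R q' = k *\<^sub>R pt p'"
    using future_null_eq_scale_pt[OF e(2)] by blast
  have "(1 / k) *\<^sub>R (e *\<^sub>R q') = pt p'"
    unfolding k(2) using k(1) by simp
  then have "pt p' = (e / k) *\<^sub>R q'"
    by simp
  then have *: "mink (pt p') c = 0" "mink (pt p') d = 0" "mink (pt p') q \<noteq> 0"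
    using q'0 q'q e(1) k(1) by (auto simp: mink_linear)
  then have "p' \<noteq> p"
    using q by (auto simp: q_def)
  then show ?thesis
    using that[of p'] * assms by (simp add: ext_sphere_of)
qed

text \<open>The map \<open>J\<close> turns the form into the Euclidean inner product, and three
  linear conditions cannot exhaust dimension at least four.\<close>

lemma orthogonal_vector_exists:
  fixes c d h :: "'n::finite lvec"
  assumes "CARD('n) \<ge> 2"
  obtains w where "w \<noteq> 0" "mink w c = 0" "mink w d = 0" "mink w h = 0"
proof -
  define J :: "'n lvec \<Rightarrow> 'n lvec" where "J a = (fst a, - snd (snd a) / 2, - fst (snd a) / 2)" for a
  have J: "mink w a = w \<bullet> J a" for w a
    by (simp add: mink_def J_def inner_prod_def add_divide_distrib)
  have "dim {J c, J d, J h} \<le> card {J c, J d, J h}"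
    by (rule dim_le_card') simp
  also have "\<dots> \<le> 3"
    by (simp add: card_insert_if)
  also have "3 < DIM('n lvec)"
    using assms by simp
  finally obtain w where "w \<noteq> 0" "\<And>y. y \<in> span {J c, J d, J h} \<Longrightarrow> orthogonal w y"
    using orthogonal_to_subspace_exists by blast
  then have "w \<noteq> 0" "mink w c = 0" "mink w d = 0" "mink w h = 0"
    by (auto simp: J orthogonal_def span_base)
  then show ?thesis by (rule that)
qed

text \<open>A normalised timelike \<open>h\<close> plus a normalised spacelike \<open>w\<close>,
  mutually orthogonal and both orthogonal to \<open>c\<close> and \<open>d\<close>, is null and
  gives the point.\<close>

lemma common_point_exists:
  fixes c d :: "'n::finite lvec"
  assumes "unit c" "unit d" "\<bar>mink c d\<bar> < 1" "CARD('n) \<ge> 2"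
  shows "ext (sphere_of c) \<inter> ext (sphere_of d) \<noteq> {}"
proof -
  obtain h where h: "mink h h < 0" "mink h c = 0" "mink h d = 0"
    using timelike_orthogonal_exists assms by blast
  obtain w where w: "w \<noteq> 0" "mink w c = 0" "mink w d = 0" "mink w h = 0"
    using orthogonal_vector_exists[OF assms(4)] by blast
  have ww: "mink w w > 0"
    using timelike_orthogonal[OF h(1) w(4)] w(1) by force
  define q where "q = (1 / sqrt (- mink h h)) *\<^sub>R h + (1 / sqrt (mink w w)) *\<^sub>R w"
  have "mink q q = mink h h / (- mink h h) + mink w w / mink w w"
    using h ww w by (simp add: q_def mink_linear mink_commute[of h w] real_sqrt_mult_self)
  then have "mink q q = 0"
    using h ww by simp
  moreover have "mink q h \<noteq> 0"
    using h w by (simp add: q_def mink_linear)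
  then have "q \<noteq> 0"
    by auto
  ultimately obtain e where e: "e = 1 \<or> e = - 1" "future_null (e *\<^sub>R q)"
    using future_null_cases by (metis scaleR_minus1_left scaleR_one)
  obtain k p where k: "k > 0" "e *\<^sub>R q = k *\<^sub>R pt p"
    using future_null_eq_scale_pt[OF e(2)] by blast
  have "mink (e *\<^sub>R q) c = 0" "mink (e *\<^sub>R q) d = 0"
    using h w by (simp_all add: q_def mink_linear)
  then have "mink (pt p) c = 0" "mink (pt p) d = 0"
    using k by (simp_all add: mink_linear)
  then show ?thesis
    using assms by (auto simp: ext_sphere_of)
qed

text \<open>One of \<open>c + d\<close> and \<open>c - d\<close> is timelike, and a common point
  would be orthogonal to it.\<close>

lemma no_common_point:
  assumes "unit c" "unit d" "\<bar>mink c d\<bar> > 1"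
  shows "ext (sphere_of c) \<inter> ext (sphere_of d) = {}"
proof (rule ccontr)
  assume "\<not> ?thesis"
  then obtain p where p: "mink (pt p) c = 0" "mink (pt p) d = 0"
    using assms by (auto simp: ext_sphere_of)
  define h where "h = (if mink c d < 0 then c + d else c - d)"
  have "mink h h < 0"
    using assms by (auto simp: h_def mink_linear unit_def mink_commute[of d c])
  moreover have "mink (pt p) h = 0"
    using p by (simp add: h_def mink_linear)
  ultimately have "pt p = 0"
    using timelike_orthogonal[of h "pt p"] future_null_pt[of p] by (simp add: future_null_def)
  then show False
    using future_null_nonzero[OF future_null_pt] by blast
qed

text \<open>The null vector \<open>c + d\<close> is orthogonal to both spheres and so is a common
  point. Any other common point is orthogonal to it, hence on the same ray.\<close>

lemma touching_point:
  assumes "unit c" "unit d" "mink c d = - 1" "c \<noteq> - d"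
  shows "tangent (sphere_of c) (sphere_of d)"
proof -
  define w where "w = c + d"
  have "w \<noteq> 0"
    using assms(4) by (simp add: w_def add_eq_0_iff2)
  moreover have ww: "mink w w = 0"
    using assms by (simp add: w_def mink_linear unit_def mink_commute[of d c])
  ultimately obtain e where e: "e = 1 \<or> e = - 1" "future_null (e *\<^sub>R w)"
    using future_null_cases by (metis scaleR_minus1_left scaleR_one)
  obtain k p where k: "k > 0" "e *\<^sub>R w = k *\<^sub>R pt p"
    using future_null_eq_scale_pt[OF e(2)] by blast
  have "mink (e *\<^sub>R w) c = 0" "mink (e *\<^sub>R w) d = 0"
    using assms by (simp_all add: w_def mink_linear unit_def mink_commute[of d c])
  then have p: "mink (pt p) c = 0" "mink (pt p) d = 0"
    using k by (simp_all add: mink_linear)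
  have "p' = p" if "mink (pt p') c = 0" "mink (pt p') d = 0" for p'
  proof -
    have "mink (pt p') (e *\<^sub>R w) = 0"
      using that by (simp add: w_def mink_linear)
    then have "mink (pt p') (pt p) = 0"
      using k by (simp add: mink_linear)
    then show ?thesis
      using mink_future(2)[OF future_nullD future_nullD, OF future_null_pt future_null_pt, of p' p] pt_eq_scale
      by blast
  qed
  then have "ext (sphere_of c) \<inter> ext (sphere_of d) = {p}"
    using p unfolding ext_sphere_of[OF assms(1)] ext_sphere_of[OF assms(2)] by blast
  then show ?thesis
    unfolding tangent_def by blast
qed

lemma not_tangent_self: "unit c \<Longrightarrow> \<not> tangent (sphere_of c) (sphere_of c)"
  using ext_sphere_of_two_points[of c] unfolding tangent_def by (metis inf.idem singletonD)

text \<open>For a product of modulus below 1 it suffices that a common point is never the only one,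
  so the equivalence holds in every dimension.\<close>

lemma tangent_iff:
  assumes "unit c" "unit d"
  shows "tangent (sphere_of c) (sphere_of d) \<longleftrightarrow> \<bar>mink c d\<bar> = 1 \<and> c \<noteq> d \<and> c \<noteq> - d"
proof
  assume t: "tangent (sphere_of c) (sphere_of d)"
  then obtain p where p: "ext (sphere_of c) \<inter> ext (sphere_of d) = {p}"
    by (auto simp: tangent_def)
  have "\<not> \<bar>mink c d\<bar> < 1"
    using common_point_not_unique[OF assms, of p] p by (metis singletonD singletonI)
  moreover have "\<not> \<bar>mink c d\<bar> > 1"
    using no_common_point[OF assms] p by auto
  ultimately have "\<bar>mink c d\<bar> = 1"
    by linarith
  moreover have "c \<noteq> d \<and> c \<noteq> - d"
    using not_tangent_self[OF assms(2)] t by auto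
  ultimately show "\<bar>mink c d\<bar> = 1 \<and> c \<noteq> d \<and> c \<noteq> - d"
    by blast
next
  assume *: "\<bar>mink c d\<bar> = 1 \<and> c \<noteq> d \<and> c \<noteq> - d"
  then consider "mink c d = - 1" | "mink c (- d) = - 1"
    by (auto simp: mink_linear abs_if split: if_splits)
  then show "tangent (sphere_of c) (sphere_of d)"
    using touching_point[of c d] touching_point[of c "- d"] * assms by cases auto
qed

text \<open>On the line, interlaced spheres are disjoint although their product lies strictly
  between -1 and 1; the last hypothesis excludes this.\<close>

lemma nonintersecting_imp:
  fixes c d :: "'n::finite lvec"
  assumes "unit c" "unit d" "nonintersecting (sphere_of c) (sphere_of d)" "tangent (sphere_of c) (sphere_of d) \<or> CARD('n) \<ge> 2"
  shows "\<bar>mink c d\<bar> \<ge> 1"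
  using assms common_point_exists[OF assms(1,2)] tangent_iff[OF assms(1,2)]
  unfolding nonintersecting_def by fastforce

lemma nonintersectingI:
  assumes "unit c" "unit d" "\<bar>mink c d\<bar> \<ge> 1" "c \<noteq> d" "c \<noteq> - d"
  shows "nonintersecting (sphere_of c) (sphere_of d)"
  using assms tangent_iff[OF assms(1,2)] no_common_point[OF assms(1,2)] sphere_of_eq_iff[OF assms(1,2)]
  unfolding nonintersecting_def by (metis less_eq_real_def minus_minus)

text \<open>The open sides of \<open>c\<close> and \<open>s\<close> are disjoint and touch.  Without the null vector pointing to the
  future, the two sides would cover everything instead.\<close>

definition kiss :: "'n::finite lvec \<Rightarrow> 'n lvec \<Rightarrow> bool" where
  "kiss c s \<longleftrightarrow> mink c s = - 1 \<and> future_null (c + s)"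

section \<open>Kissing expressed by orientations\<close>

text \<open>On \<open>S\<close> the product with \<open>c\<close> equals the product with the future
  vector \<open>c + s\<close>, hence is never positive.\<close>

lemma kissesI:
  assumes "unit c" "\<And>S. S \<in> F \<Longrightarrow> \<exists>s. unit s \<and> S = sphere_of s \<and> kiss c s"
  shows "kisses F (sphere_of c)"
proof -
  have "tangent (sphere_of c) S \<and> ext S \<inter> {p. mink (pt p) c > 0} = {}" if S: "S \<in> F" for S
  proof -
    obtain s where s: "unit s" "S = sphere_of s" "mink c s = - 1" "future_null (c + s)"
      using assms(2)[OF S] by (auto simp: kiss_def)
    have "c + s \<noteq> 0"
      using s(4) future_null_nonzero by blast
    then have "tangent (sphere_of c) S"
      using touching_point[OF assms(1) s(1,3)] s(2) by (auto simp: add_eq_0_iff2)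
    moreover have "mink (pt p) c \<le> 0" if "mink (pt p) s = 0" for p
      using mink_future(1)[OF future_nullD future_nullD, OF future_null_pt s(4), of p] that
      by (simp add: mink_linear)
    ultimately show ?thesis
      using s by (force simp: ext_sphere_of)
  qed
  moreover have "open_side {p. mink (pt p) c > 0} (sphere_of c)"
    using assms(1) open_side_iff by blast
  ultimately show ?thesis
    unfolding kisses_def using assms(1) gsphere_iff by blast
qed

text \<open>The side free of the family orients \<open>c\<close>, and the sign of the product
  orients \<open>s\<close>. If \<open>c + s\<close> pointed to the past, every point of
  \<open>S\<close> would lie on the ray of \<open>- (c + s)\<close>, but \<open>S\<close> has two
  points.\<close>

lemma kissesE:
  assumes "kisses F C" "\<And>S. S \<in> F \<Longrightarrow> gsphere S"
  obtains c where "unit c" "C = sphere_of c" "\<And>S. S \<in> F \<Longrightarrow> \<exists>s. unit s \<and> S = sphere_of s \<and> kiss c s"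
proof -
  obtain U where U: "open_side U C" "\<And>S. S \<in> F \<Longrightarrow> ext S \<inter> U = {}" "\<And>S. S \<in> F \<Longrightarrow> tangent C S"
    using assms(1) by (auto simp: kisses_def)
  obtain c where c: "unit c" "C = sphere_of c" "U = {p. mink (pt p) c > 0}"
    using U(1) open_side_iff by blast
  have "\<exists>s. unit s \<and> S = sphere_of s \<and> kiss c s" if S: "S \<in> F" for S
  proof -
    obtain s0 where s0: "unit s0" "S = sphere_of s0"
      using assms(2)[OF S] gsphere_iff by blast
    have "\<bar>mink c s0\<bar> = 1 \<and> c \<noteq> s0 \<and> c \<noteq> - s0"
      using U(3)[OF S] tangent_iff[OF c(1) s0(1)] c s0 by auto
    moreover define s where "s = (if mink c s0 > 0 then - s0 else s0)"
    ultimately have s: "unit s" "S = sphere_of s" "mink c s = - 1" "c \<noteq> - s"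
      using s0 by (auto simp: mink_linear abs_if split: if_splits)
    have "c + s \<noteq> 0"
      using s(4) by (simp add: add_eq_0_iff2)
    moreover have "mink (c + s) (c + s) = 0"
      using c s by (simp add: mink_linear unit_def mink_commute[of s c])
    ultimately consider "future_null (c + s)" | "future_null (- (c + s))"
      using future_null_cases by blast
    then show ?thesis
    proof cases
      case 1
      then show ?thesis using s unfolding kiss_def by blast
    next
      case 2
      obtain p q where pq: "p \<in> ext S" "q \<in> ext S" "p \<noteq> q"
        using ext_sphere_of_two_points s by metis
      have "\<exists>k>0. pt r = k *\<^sub>R (- (c + s))" if "r \<in> ext S" for r
      proof -
        have "mink (pt r) c \<le> 0"
          using U(2)[OF S] that c(3) by force
        moreover have "mink (pt r) s = 0"
          using that s by (simp add: ext_sphere_of)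
        ultimately have "mink (pt r) (- (c + s)) \<ge> 0"
          by (simp add: mink_linear)
        then show ?thesis
          using mink_future[OF future_nullD future_nullD, OF future_null_pt 2, of r] by force
      qed
      then obtain k l where "k > 0" "pt p = k *\<^sub>R (- (c + s))" "l > 0" "pt q = l *\<^sub>R (- (c + s))"
        using pq by metis
      then have "pt p = (k / l) *\<^sub>R pt q"
        by simp
      then show ?thesis
        using pt_eq_scale pq by blast
    qed
  qed
  then show ?thesis
    using that c by blast
qed

section \<open>Spheres kissing a non-intersecting pair\<close>

text \<open>Causality of the sum orients a non-intersecting pair so that its open sides are
  disjoint. The sum is null exactly when the two touch, and is then the ray of their touching
  point.\<close>

locale sphere_pair =
  fixes s1 s2 :: "'n::finite lvec"
  assumes unit1: "unit s1" and unit2: "unit s2" and future: "causal (s1 + s2)"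
begin

abbreviation \<nu> :: "'n lvec" where "\<nu> \<equiv> s1 + s2"

definition between :: "'n lvec \<Rightarrow> bool" where
  "between c \<longleftrightarrow> unit c \<and> kiss c s1 \<and> kiss c s2"

lemma swap: "sphere_pair s2 s1"
  using unit1 unit2 future by (simp add: sphere_pair_def add.commute)

lemma mink_pair: "mink s1 s1 = 1" "mink s2 s2 = 1" "mink s2 s1 = mink s1 s2" "mink s1 s2 \<le> - 1"
  using unit1 unit2 future by (simp_all add: unit_def causal_def mink_linear mink_commute[of s2 s1])

lemma future_null_pair_iff: "future_null \<nu> \<longleftrightarrow> mink s1 s2 = - 1"
  using future by (auto simp: causal_def future_null_def mink_linear mink_pair)

lemma mink_between:
  assumes "between c"
  shows "mink c c = 1" "mink c s1 = - 1" "mink c s2 = - 1" "mink s1 c = - 1" "mink s2 c = - 1" "future_null (c + s1)" "future_null (c + s2)"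
  using assms by (auto simp: between_def kiss_def unit_def mink_commute)

text \<open>Exotic kissing spheres: if the two spheres touch at infinity, these are the hyperplanes parallel
  to them that do not lie between them.\<close>

lemma kiss_opposite:
  assumes "unit c" "kiss c (- s1)" "kiss c s2"
  shows "future_null \<nu> \<and> (\<exists>\<mu>>0. c = s1 + \<mu> *\<^sub>R \<nu>)"
proof -
  have c: "mink c s1 = 1" "mink c s2 = - 1" "future_null (c - s1)"
    using assms by (simp_all add: kiss_def mink_linear)
  have eq: "mink (c - s1) \<nu> = - 1 - mink s1 s2"
    by (simp add: mink_linear c mink_pair)
  then have "mink (c - s1) \<nu> = 0"
    using mink_future(1)[OF future_nullD[OF c(3)] future] mink_pair(4) by linarith
  then obtain \<mu> where "\<mu> > 0" "c - s1 = \<mu> *\<^sub>R \<nu>"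
    using mink_future(2)[OF future_nullD[OF c(3)] future] by blast
  moreover have "c = s1 + (c - s1)"
    by simp
  ultimately show ?thesis
    using eq \<open>mink (c - s1) \<nu> = 0\<close> future_null_pair_iff by (metis diff_eq_eq diff_0 eq_iff_diff_eq_0 minus_diff_eq)
qed

text \<open>Both orientations cannot be reversed at once, since the future null
  \<open>c - s1\<close> would have positive product with \<open>\<nu>\<close>.\<close>

lemma kiss_cases:
  assumes "unit c" "kiss c s1 \<or> kiss c (- s1)" "kiss c s2 \<or> kiss c (- s2)"
  shows "between c \<or> (future_null \<nu> \<and> (\<exists>\<mu>>0. c = s1 + \<mu> *\<^sub>R \<nu> \<or> c = s2 + \<mu> *\<^sub>R \<nu>))"
proof -
  have "\<not> (kiss c (- s1) \<and> kiss c (- s2))"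
  proof
    assume *: "kiss c (- s1) \<and> kiss c (- s2)"
    then have "mink (c - s1) \<nu> = 1 - mink s1 s2" "future_null (c - s1)"
      by (simp_all add: kiss_def mink_linear mink_pair)
    then show False
      using mink_future(1)[OF future_nullD future, of "c - s1"] mink_pair(4) by simp
  qed
  then show ?thesis
    using assms kiss_opposite sphere_pair.kiss_opposite[OF swap, of c]
    unfolding between_def by (metis add.commute)
qed

text \<open>Otherwise \<open>x - y\<close> is not spacelike and is orthogonal to
  \<open>\<nu>\<close>, hence a multiple of it. Orthogonality to \<open>s1\<close> then forces the
  pair to touch, and the unit norm makes the multiple zero.\<close>

lemma between_mink_less:
  assumes "between x" "between y" "x \<noteq> y"
  shows "mink x y < 1"
proof (rule ccontr)
  assume "\<not> mink x y < 1"
  note x = mink_between[OF assms(1)] and y = mink_between[OF assms(2)]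
  have "mink (x - y) \<nu> = 0" "mink (x - y) (x - y) \<le> 0"
    using \<open>\<not> mink x y < 1\<close> by (simp_all add: mink_linear x y mink_commute[of y x])
  then obtain k where k: "x - y = k *\<^sub>R \<nu>"
    using causal_orthogonal[OF future] by blast
  then have xy: "x = y + k *\<^sub>R \<nu>"
    by (metis add.commute diff_add_cancel)
  have "k \<noteq> 0"
    using k assms(3) by auto
  have "mink (x - y) s1 = 0"
    by (simp add: mink_linear x y)
  then have "mink s1 s2 = - 1"
    using \<open>k \<noteq> 0\<close> unfolding k by (simp add: mink_linear mink_pair)
  have "1 = mink (y + k *\<^sub>R \<nu>) (y + k *\<^sub>R \<nu>)"
    using x(1) xy by simp
  also have "\<dots> = 1 - 4 * k"
    by (simp add: mink_linear y mink_pair \<open>mink s1 s2 = - 1\<close>)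
  finally show False
    using \<open>k \<noteq> 0\<close> by simp
qed

section \<open>The tangent pencil of a touching pair\<close>

text \<open>For null \<open>\<nu>\<close> these are the spheres touching the pair at its own
  touching point; \<open>k = 0\<close> and \<open>k = - 1\<close> give the pair itself.\<close>

definition in_pencil :: "'n lvec \<Rightarrow> bool" where
  "in_pencil t \<longleftrightarrow> (\<exists>k. t = s2 + k *\<^sub>R \<nu> \<or> - t = s2 + k *\<^sub>R \<nu>)"

text \<open>The product of the future vectors \<open>c + t\<close> and \<open>\<nu>\<close> is at
  most 0; if it vanished, they would be parallel and \<open>t\<close> would lie in the
  pencil.\<close>

lemma pencil_kiss:
  assumes "future_null \<nu>" "c = s1 + \<mu> *\<^sub>R \<nu> \<or> c = s2 + \<mu> *\<^sub>R \<nu>" "kiss c t" "\<not> in_pencil t"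
  shows "mink t \<nu> < 0"
proof -
  have g: "mink s1 s2 = - 1"
    using assms(1) future_null_pair_iff by simp
  have "mink c \<nu> = 0"
    using assms(2) by (auto simp: mink_linear mink_pair g)
  then have eq: "mink (c + t) \<nu> = mink t \<nu>"
    by (simp add: mink_linear)
  have f: "future_null (c + t)"
    using assms(3) by (simp add: kiss_def)
  have "mink t \<nu> \<noteq> 0"
  proof
    assume "mink t \<nu> = 0"
    then obtain k where k: "c + t = k *\<^sub>R \<nu>"
      using mink_future(2)[OF future_nullD[OF f] future] eq by metis
    from assms(2) have "in_pencil t"
    proof
      assume c: "c = s1 + \<mu> *\<^sub>R \<nu>"
      have "t = k *\<^sub>R \<nu> - c"
        using k by (metis add_diff_cancel_left')
      also have "\<dots> = s2 + (k - \<mu> - 1) *\<^sub>R \<nu>"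
        unfolding c by (simp add: scaleR_diff_left)
      finally show ?thesis
        unfolding in_pencil_def by blast
    next
      assume c: "c = s2 + \<mu> *\<^sub>R \<nu>"
      have "- t = c - k *\<^sub>R \<nu>"
        using k by (metis add_diff_cancel_left' minus_diff_eq)
      also have "\<dots> = s2 + (\<mu> - k) *\<^sub>R \<nu>"
        unfolding c by (simp add: scaleR_diff_left)
      finally show ?thesis
        unfolding in_pencil_def by blast
    qed
    then show False using assms(4) by blast
  qed
  then show ?thesis
    using mink_future(1)[OF future_nullD[OF f] future] eq by linarith
qed

text \<open>By \<open>pencil_kiss\<close> both spheres see the same orientation of \<open>t\<close>.
  Beyond the same member of the pair, tangency is a linear equation for \<open>\<mu>\<close>. Beyond
  different members, both products of \<open>t\<close> with the pair exceed -1 while their sum is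
  negative, so neither has modulus at least 1.\<close>

lemma pencil_kiss_unique:
  assumes "future_null \<nu>" "\<not> in_pencil t" "\<bar>mink t s1\<bar> \<ge> 1 \<or> \<bar>mink t s2\<bar> \<ge> 1"
    and "\<mu> > 0" "c = s1 + \<mu> *\<^sub>R \<nu> \<or> c = s2 + \<mu> *\<^sub>R \<nu>" "kiss c t"
    and "\<mu>' > 0" "c' = s1 + \<mu>' *\<^sub>R \<nu> \<or> c' = s2 + \<mu>' *\<^sub>R \<nu>" "kiss c' t \<or> kiss c' (- t)"
  shows "c' = c"
proof -
  define a where "a = mink t \<nu>"
  have a: "a < 0"
    using pencil_kiss[OF assms(1,5,6,2)] by (simp add: a_def)
  have "\<not> kiss c' (- t)"
    using pencil_kiss[OF assms(1,8), of "- t"] assms(2) a by (auto simp: in_pencil_def a_def mink_linear)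
  then have t: "mink t c = - 1" "mink t c' = - 1"
    using assms(6,9) by (auto simp: kiss_def mink_commute)
  have sum: "mink t s1 + mink t s2 = a"
    by (simp add: a_def mink_linear)
  have m: "\<mu> * a < 0" "\<mu>' * a < 0"
    using a assms(4,7) by (simp_all add: mult_pos_neg)
  consider "c = s1 + \<mu> *\<^sub>R \<nu>" "c' = s1 + \<mu>' *\<^sub>R \<nu>" | "c = s2 + \<mu> *\<^sub>R \<nu>" "c' = s2 + \<mu>' *\<^sub>R \<nu>"
    | "c = s1 + \<mu> *\<^sub>R \<nu>" "c' = s2 + \<mu>' *\<^sub>R \<nu>" | "c = s2 + \<mu> *\<^sub>R \<nu>" "c' = s1 + \<mu>' *\<^sub>R \<nu>"
    using assms(5,8) by blast
  then show ?thesis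
  proof cases
    case 1
    then have "mink t s1 + \<mu> * a = - 1" "mink t s1 + \<mu>' * a = - 1"
      using t unfolding a_def by (simp_all add: mink_add_right mink_scale_right del: scaleR_add_right)
    then have "\<mu> * a = \<mu>' * a"
      by linarith
    then show ?thesis using a 1 by simp
  next
    case 2
    then have "mink t s2 + \<mu> * a = - 1" "mink t s2 + \<mu>' * a = - 1"
      using t unfolding a_def by (simp_all add: mink_add_right mink_scale_right del: scaleR_add_right)
    then have "\<mu> * a = \<mu>' * a"
      by linarith
    then show ?thesis using a 2 by simp
  next
    case 3
    then have "mink t s1 + \<mu> * a = - 1" "mink t s2 + \<mu>' * a = - 1"
      using t unfolding a_def by (simp_all add: mink_add_right mink_scale_right del: scaleR_add_right)
    then show ?thesis using a m sum assms(3) by linarith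
  next
    case 4
    then have "mink t s2 + \<mu> * a = - 1" "mink t s1 + \<mu>' * a = - 1"
      using t unfolding a_def by (simp_all add: mink_add_right mink_scale_right del: scaleR_add_right)
    then show ?thesis using a m sum assms(3) by linarith
  qed
qed

lemma between_pencil_mink:
  assumes "future_null \<nu>" "between x" "\<mu> > 0" "c = s1 + \<mu> *\<^sub>R \<nu> \<or> c = s2 + \<mu> *\<^sub>R \<nu>"
  shows "mink x c < - 1"
  using assms(3,4) mink_between[OF assms(2)] by (auto simp: mink_linear)

section \<open>Spheres squeezed between a member of the family and the pair\<close>

text \<open>The sphere \<open>y\<close> is squeezed between \<open>t\<close> and \<open>s1\<close>, which touch where \<open>y\<close> touches them.\<close>

lemma opposite_sides:
  assumes "between x" "between y" "kiss x t" "kiss y (- t)" "mink t s1 \<le> - 1"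
  shows "mink x y < - 1 \<and> (\<exists>k>0. t + s1 = k *\<^sub>R (y + s1))"
proof -
  note x = mink_between[OF assms(1)] and y = mink_between[OF assms(2)]
  have t: "mink x t = - 1" "mink y t = 1" "future_null (y - t)" "mink t y = 1"
    using assms(3,4) by (auto simp: kiss_def mink_linear mink_commute)
  have "x \<noteq> y"
    using t by auto
  then have g: "mink x y < 1"
    using between_mink_less assms by blast
  have eq: "mink (y - t) (y + s1) = - 1 - mink t s1"
    by (simp add: mink_linear y t)
  have "mink (y - t) (y + s1) = 0"
    using mink_future(1)[OF future_nullD future_nullD, OF t(3) y(6)] eq assms(5) by linarith
  then obtain l where l: "l > 0" "y - t = l *\<^sub>R (y + s1)"
    using mink_future(2)[OF future_nullD future_nullD, OF t(3) y(6)] by blast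
  then have tl: "t = y - l *\<^sub>R (y + s1)"
    by (metis add_diff_cancel_left' diff_add_cancel)
  \<comment> \<open>This amounts to \<open>(1 - mink x y) * (1 - l) = 2\<close> and
    \<open>(mink x y + 1) * (1 - l) = - 2 * l\<close>: the first gives \<open>l < 1\<close>, the
    second then \<open>mink x y < - 1\<close>.\<close>
  have e: "mink x y * (1 - l) + l = - 1"
    using t(1) unfolding tl by (simp add: mink_linear x algebra_simps)
  have "l < 1"
  proof (rule ccontr)
    assume "\<not> l < 1"
    then have "(1 - mink x y) * (1 - l) \<le> 0"
      using g by (intro mult_nonneg_nonpos) auto
    then show False using e by (simp add: algebra_simps)
  qed
  moreover have "mink x y < - 1"
  proof (rule ccontr)
    assume "\<not> mink x y < - 1"
    then have "(mink x y + 1) * (1 - l) \<ge> 0"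
      using \<open>l < 1\<close> by (intro mult_nonneg_nonneg) auto
    then show False using e l by (simp add: algebra_simps)
  qed
  moreover have "t + s1 = (1 - l) *\<^sub>R (y + s1)"
    unfolding tl by (simp add: scaleR_diff_left)
  ultimately show ?thesis
    by (metis diff_gt_0_iff_gt)
qed

text \<open>If \<open>z\<close> saw \<open>t\<close> reversed like \<open>y\<close>, then
  \<open>z + s1\<close> and \<open>y + s1\<close> would both be parallel to \<open>t + s1\<close>,
  and pairing with \<open>s2\<close> would give \<open>z = y\<close>. So \<open>z\<close> sees
  \<open>t\<close> as \<open>x\<close> does, and \<open>opposite_sides\<close> applies.\<close>

lemma isolated_1:
  assumes "between x" "between y" "kiss x t" "kiss y (- t)" "mink t s1 \<le> - 1"
    and z: "between z" "kiss z t \<or> kiss z (- t)" "z \<noteq> y"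
  shows "mink y z < - 1"
proof -
  have "\<not> kiss z (- t)"
  proof
    assume "kiss z (- t)"
    then obtain k where k: "k > 0" "t + s1 = k *\<^sub>R (z + s1)"
      using opposite_sides[OF assms(1) z(1) assms(3) _ assms(5)] by blast
    obtain l where l: "l > 0" "t + s1 = l *\<^sub>R (y + s1)"
      using opposite_sides[OF assms(1-5)] by blast
    have eq: "k *\<^sub>R (z + s1) = l *\<^sub>R (y + s1)"
      using k l by simp
    have "k * mink (z + s1) s2 = l * mink (y + s1) s2"
      unfolding mink_scale_left[symmetric] eq ..
    moreover have "mink (z + s1) s2 = - 1 + mink s1 s2" "mink (y + s1) s2 = - 1 + mink s1 s2"
      by (simp_all add: mink_add_left mink_between[OF assms(2)] mink_between[OF z(1)])
    ultimately have "k * (- 1 + mink s1 s2) = l * (- 1 + mink s1 s2)"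
      by simp
    then have "k = l"
      using mink_pair(4) by simp
    then show False
      using eq k z(3) by simp
  qed
  then show ?thesis
    using opposite_sides[OF z(1) assms(2) _ assms(4,5)] z(2) mink_commute by metis
qed

text \<open>Exchanging \<open>s1\<close> and \<open>s2\<close>, or \<open>x\<close> and
  \<open>y\<close> together with the sign of \<open>t\<close>, reduces every case to
  \<open>isolated_1\<close>. The witness is the squeezed sphere.\<close>

lemma isolated:
  assumes "between x" "between y" "kiss x t" "kiss y (- t)" "\<bar>mink t s1\<bar> \<ge> 1 \<or> \<bar>mink t s2\<bar> \<ge> 1"
  obtains w where "w = x \<or> w = y"
    "\<And>z. between z \<Longrightarrow> kiss z t \<or> kiss z (- t) \<Longrightarrow> z \<noteq> w \<Longrightarrow> mink w z < - 1"
proof -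
  interpret swap: sphere_pair s2 s1 by (rule swap)
  have b: "swap.between z \<longleftrightarrow> between z" for z
    by (auto simp: swap.between_def between_def)
  consider "mink t s1 \<le> - 1" | "mink (- t) s1 \<le> - 1" | "mink t s2 \<le> - 1" | "mink (- t) s2 \<le> - 1"
    using assms(5) by (auto simp: mink_linear abs_if split: if_splits)
  then show ?thesis
  proof cases
    case 1
    then show ?thesis using isolated_1[OF assms(1-4)] that by blast
  next
    case 2
    then show ?thesis using isolated_1[OF assms(2,1,4)] assms(3) that by simp blast
  next
    case 3
    then show ?thesis using swap.isolated_1[of x y t] assms b that by blast
  next
    case 4
    then show ?thesis using swap.isolated_1[of y x "- t"] assms b that by simp blast
  qed
qed

text \<open>Members of a tangent pencil behave like parallel hyperplanes: those beyond the whole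
  family kiss it and touch each other. Thus the finiteness clause of an S-family excludes families
  inside one pencil.\<close>

lemma infinite_pencil_arrangement:
  assumes "future_null \<nu>" "finite F" "\<And>S. S \<in> F \<Longrightarrow> \<exists>t. S = sphere_of t \<and> in_pencil t"
  obtains \<C> where "kissing_arrangement F \<C>" "infinite \<C>"
proof -
  have g: "mink s1 s2 = - 1"
    using assms(1) future_null_pair_iff by simp
  have n: "mink s2 \<nu> = 0" "mink \<nu> s2 = 0" "mink \<nu> \<nu> = 0"
    by (simp_all add: mink_linear mink_pair g)
  have "\<exists>k. S = sphere_of (s2 + k *\<^sub>R \<nu>)" if "S \<in> F" for S
    using assms(3)[OF that] sphere_of_minus unfolding in_pencil_def by metis
  then obtain k where k: "\<And>S. S \<in> F \<Longrightarrow> S = sphere_of (s2 + k S *\<^sub>R \<nu>)"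
    by metis
  define b where "b = (\<Sum>S\<in>F. \<bar>k S\<bar>)"
  have b: "k S \<le> b" if "S \<in> F" for S
    using member_le_sum[of S F "\<lambda>S. \<bar>k S\<bar>"] that assms(2) by (simp add: b_def)
  define c where "c l = s2 + l *\<^sub>R \<nu>" for l :: real
  have cc: "mink (c l) (c l') = 1" for l l'
    unfolding c_def mink_add_left[of s2] mink_add_right[of _ s2] mink_scale_left mink_scale_right n mink_pair by simp
  have u: "unit (c l)" for l
    by (simp add: unit_def cc)
  have nz: "\<nu> \<noteq> 0"
    using future_null_nonzero[OF assms(1)] .
  have inj: "c l = c l' \<longleftrightarrow> l = l'" for l l'
    using nz unfolding c_def by (simp del: scaleR_add_right)
  have opp: "c l \<noteq> - c l'" for l l'
    using cc[of l l'] cc[of l' l'] by (auto simp: mink_linear)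
  have kisses: "kisses F (sphere_of (c l))" if "l > b" for l
  proof (rule kissesI[OF u])
    fix S assume S: "S \<in> F"
    let ?s = "- c (k S)"
    have "unit ?s"
      using u by simp
    moreover have "S = sphere_of ?s"
      unfolding sphere_of_minus unfolding c_def by (rule k[OF S])
    moreover have "mink (c l) ?s = - 1"
      by (simp add: mink_linear cc)
    moreover have "c l + ?s = (l - k S) *\<^sub>R \<nu>"
      unfolding c_def by (simp add: scaleR_diff_left del: scaleR_add_right)
    then have "future_null (c l + ?s)"
      using future_null_scale[OF assms(1), of "l - k S"] that b[OF S] by simp
    ultimately show "\<exists>s. unit s \<and> S = sphere_of s \<and> kiss (c l) s"
      unfolding kiss_def by blast
  qed
  have tan: "tangent (sphere_of (c l)) (sphere_of (c l'))" if "l \<noteq> l'" for l l'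
    using tangent_iff[OF u u] cc inj opp that by simp
  let ?C = "(\<lambda>l. sphere_of (c l)) ` {b<..}"
  have "kissing_arrangement F ?C"
    unfolding kissing_arrangement_def
  proof (intro conjI ballI impI)
    fix C assume "C \<in> ?C"
    then obtain l where l: "l > b" "C = sphere_of (c l)"
      by auto
    then show "kisses F C"
      using kisses by simp
    show "\<exists>D\<in>?C. tangent C D"
      using l tan[of l "l + 1"] by force
    fix D assume "D \<in> ?C" and CD: "C \<noteq> D"
    then obtain l' where "D = sphere_of (c l')"
      by auto
    then show "nonintersecting C D"
      using l tan[of l l'] CD unfolding nonintersecting_def by (cases "l = l'") simp_all
  qed
  moreover have "inj_on (\<lambda>l. sphere_of (c l)) {b<..}"
    using sphere_of_eq_iff[OF u u] inj opp unfolding inj_on_def by blast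
  then have "infinite ?C"
    using finite_imageD infinite_Ioi by blast
  ultimately show ?thesis
    using that by blast
qed

end

section \<open>Reflections\<close>

definition reflect :: "'n::finite lvec \<Rightarrow> 'n lvec \<Rightarrow> 'n lvec" where
  "reflect w z = z - (2 * mink z w / mink w w) *\<^sub>R w"

lemma mink_reflect:
  assumes "mink w w \<noteq> 0"
  shows "mink (reflect w a) (reflect w b) = mink a b"
  using assms by (simp add: reflect_def mink_linear mink_commute[of w b] field_simps)

lemma reflect_reflect:
  assumes "mink w w \<noteq> 0"
  shows "reflect w (reflect w a) = a"
  using assms by (simp add: reflect_def mink_linear)

lemma reflect_orthogonal: "mink z w = 0 \<Longrightarrow> reflect w z = z"
  by (simp add: reflect_def)

lemma reflect_add: "reflect w (a + b) = reflect w a + reflect w b"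
  by (simp add: reflect_def mink_linear add_divide_distrib scaleR_add_left distrib_left)

text \<open>A moved null vector has negative product with its image, which places both in the same
  cone.\<close>

lemma future_null_reflect:
  assumes "mink w w > 0" "future_null q"
  shows "future_null (reflect w q)"
proof (cases "mink q w = 0")
  case True
  then show ?thesis using assms by (simp add: reflect_orthogonal)
next
  case False
  have qq: "mink q q = 0"
    using assms by (simp add: future_null_def)
  then have "mink q (reflect w q) = - (2 * (mink q w)\<^sup>2 / mink w w)"
    by (simp add: reflect_def mink_linear power2_eq_square)
  then have neg: "mink q (reflect w q) < 0"
    using assms False by simp
  then have "reflect w q \<noteq> 0"
    by auto
  moreover have "mink (reflect w q) (reflect w q) = 0"
    using mink_reflect[of w q q] assms qq by simp
  ultimately consider "future_null (reflect w q)" | "future_null (- reflect w q)"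
    using future_null_cases by blast
  then show ?thesis
  proof cases
    case 2
    then show ?thesis
      using mink_future(1)[OF future_nullD future_nullD, OF assms(2) 2] neg by (simp add: mink_linear)
  qed
qed

locale oriented_family = sphere_pair +
  fixes A :: "'a::finite lvec set"
  assumes pair: "s1 \<in> A" "s2 \<in> A"
begin

definition \<Sigma> :: "'a lvec set" where
  "\<Sigma> = {c. unit c \<and> (\<forall>t\<in>A. kiss c t)}"

lemma \<Sigma>_between: "c \<in> \<Sigma> \<Longrightarrow> between c"
  using pair by (auto simp: \<Sigma>_def between_def)

lemma reflect_\<Sigma>:
  assumes "mink w w > 0" "\<And>t. t \<in> A \<Longrightarrow> mink t w = 0" "z \<in> \<Sigma>"
  shows "reflect w z \<in> \<Sigma>"
proof -
  have "kiss (reflect w z) t" if "t \<in> A" for t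
  proof -
    have t: "reflect w t = t"
      using assms(2)[OF that] by (rule reflect_orthogonal)
    have "mink z t = - 1" "future_null (z + t)"
      using assms(3) that by (auto simp: \<Sigma>_def kiss_def)
    then show ?thesis
      using mink_reflect[of w z t] future_null_reflect[of w "z + t"] assms(1) t
      by (simp add: kiss_def reflect_add)
  qed
  moreover have "unit (reflect w z)"
    using mink_reflect[of w z z] assms by (simp add: \<Sigma>_def unit_def)
  ultimately show ?thesis
    by (simp add: \<Sigma>_def)
qed

lemma \<Sigma>_mink: "x \<in> \<Sigma> \<Longrightarrow> mink x x = 1" "x \<in> \<Sigma> \<Longrightarrow> t \<in> A \<Longrightarrow> mink t x = - 1"
  by (auto simp: \<Sigma>_def unit_def kiss_def mink_commute)

lemma \<Sigma>_mink_less: "x \<in> \<Sigma> \<Longrightarrow> y \<in> \<Sigma> \<Longrightarrow> x \<noteq> y \<Longrightarrow> mink x y < 1"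
  using between_mink_less \<Sigma>_between by blast

definition isometry :: "('a lvec \<Rightarrow> 'a lvec) \<Rightarrow> bool" where
  "isometry T \<longleftrightarrow> bij_betw T \<Sigma> \<Sigma> \<and> (\<forall>a\<in>\<Sigma>. \<forall>b\<in>\<Sigma>. mink (T a) (T b) = mink a b)"

lemma isometry_comp: "isometry T \<Longrightarrow> isometry U \<Longrightarrow> isometry (U \<circ> T)"
  unfolding isometry_def using bij_betw_trans bij_betwE by (metis (no_types, lifting) comp_apply)

lemma isometry_swap:
  assumes "x \<in> \<Sigma>" "y \<in> \<Sigma>" "x \<noteq> y"
  shows "isometry (reflect (x - y))" "reflect (x - y) x = y"
proof -
  let ?w = "x - y"
  have ww: "mink ?w ?w = 2 - 2 * mink x y"
    using assms by (simp add: mink_linear \<Sigma>_mink mink_commute[of y x])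
  then have pos: "mink ?w ?w > 0"
    using \<Sigma>_mink_less[OF assms] by simp
  have maps: "reflect ?w z \<in> \<Sigma>" if "z \<in> \<Sigma>" for z
    using that by (rule reflect_\<Sigma>[OF pos, rotated]) (simp add: mink_linear \<Sigma>_mink assms)
  have inv: "reflect ?w (reflect ?w z) = z" for z
    using pos by (intro reflect_reflect) simp
  have "bij_betw (reflect ?w) \<Sigma> \<Sigma>"
    by (rule bij_betw_byWitness[of _ "reflect ?w"]) (auto simp: inv maps)
  then show "isometry (reflect ?w)"
    using mink_reflect[of ?w] pos by (simp add: isometry_def)
  have "2 * mink x ?w / mink ?w ?w = 1"
    using pos unfolding ww by (simp add: mink_linear \<Sigma>_mink assms)
  then show "reflect ?w x = y"
    by (simp add: reflect_def)
qed

text \<open>A Witt-type extension by induction: equal Gram entries make each earlier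
  \<open>y i\<close> orthogonal to \<open>T (x k) - y k\<close>, so the correcting reflection fixes
  it.\<close>

lemma isometry_extends:
  fixes x y :: "nat \<Rightarrow> 'a lvec"
  assumes "\<And>i. i < k \<Longrightarrow> x i \<in> \<Sigma>" "\<And>i. i < k \<Longrightarrow> y i \<in> \<Sigma>"
    and "\<And>i j. i < k \<Longrightarrow> j < k \<Longrightarrow> mink (x i) (x j) = mink (y i) (y j)"
  shows "\<exists>T. isometry T \<and> (\<forall>i<k. T (x i) = y i)"
  using assms
proof (induction k)
  case 0
  have "isometry id"
    by (simp add: isometry_def)
  then show ?case by blast
next
  case (Suc k)
  then obtain T where T: "isometry T" "\<And>i. i < k \<Longrightarrow> T (x i) = y i"
    by (metis less_Suc_eq)
  have Tk: "T (x k) \<in> \<Sigma>"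
    using T(1) Suc.prems(1) bij_betwE unfolding isometry_def by blast
  have lfT: "mink (y i) (T (x k)) = mink (y i) (y k)" if "i < k" for i
    using T(2)[OF that] T(1) Suc.prems(1)[of i] Suc.prems(1)[of k] Suc.prems(3)[of i k] that
    unfolding isometry_def by (metis less_Suc_eq)
  show ?case
  proof (cases "T (x k) = y k")
    case True
    then show ?thesis using T by (metis less_Suc_eq)
  next
    case False
    let ?R = "reflect (T (x k) - y k)"
    have yk: "y k \<in> \<Sigma>"
      using Suc.prems by simp
    have "?R (y i) = y i" if "i < k" for i
      using lfT[OF that] by (intro reflect_orthogonal) (simp add: mink_linear)
    then have "\<forall>i<Suc k. (?R \<circ> T) (x i) = y i"
      using T(2) isometry_swap(2)[OF Tk yk False] by (auto simp: less_Suc_eq)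
    then show ?thesis
      using isometry_comp[OF T(1) isometry_swap(1)[OF Tk yk False]] by blast
  qed
qed

text \<open>Lines through \<open>x\<close> in the plane of \<open>x, y, z\<close> meet \<open>\<Sigma>\<close> a second time, in the reflection of \<open>x\<close> along
  their direction.\<close>

lemma infinite_\<Sigma>:
  assumes "x \<in> \<Sigma>" "y \<in> \<Sigma>" "z \<in> \<Sigma>" "x \<noteq> y" "x \<noteq> z" "y \<noteq> z"
  shows "infinite \<Sigma>"
proof -
  define p q where "p = y - x" and "q = z - x"
  have xp: "mink x p < 0" "mink x q < 0"
    using \<Sigma>_mink_less assms by (simp_all add: p_def q_def mink_linear \<Sigma>_mink)
  have pp: "mink p p = - 2 * mink x p" "mink q q = - 2 * mink x q"
    using assms by (simp_all add: p_def q_def mink_linear \<Sigma>_mink mink_commute[of y x] mink_commute[of z x])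
  have p0: "p \<noteq> 0"
    using assms by (simp add: p_def)
  define w where "w t = q + t *\<^sub>R p" for t :: real
  \<comment> \<open>Beyond \<open>b\<close> the quadratic term of \<open>mink (w t) (w t)\<close>
    dominates the mixed one, so the direction is spacelike.\<close>
  define b where "b = 2 * \<bar>mink p q\<bar> / mink p p"
  have ww: "mink (w t) (w t) > 0" if "t > b" for t
  proof -
    have "t * mink p p > 2 * \<bar>mink p q\<bar>"
      using that xp pp by (simp add: b_def field_simps)
    moreover have "t > 0"
      using that xp pp unfolding b_def by (smt (verit) divide_nonneg_pos)
    ultimately have "t * (2 * mink p q + t * mink p p) > 0"
      by (intro mult_pos_pos) auto
    then show ?thesis
      using xp pp by (simp add: w_def mink_linear mink_commute[of q p] algebra_simps)
  qed
  have xw: "mink x (w t) < 0" if "t > b" for t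
  proof -
    have "t > 0"
      using that xp pp unfolding b_def by (smt (verit) divide_nonneg_pos)
    then show ?thesis
      using xp by (simp add: w_def mink_linear add_neg_neg mult_pos_neg)
  qed
  define f where "f t = reflect (w t) x" for t
  have f\<Sigma>: "f t \<in> \<Sigma>" if "t > b" for t
    unfolding f_def using assms
    by (intro reflect_\<Sigma>[OF ww[OF that]]) (simp_all add: w_def p_def q_def mink_linear \<Sigma>_mink)
  define m where "m t = - (2 * mink x (w t) / mink (w t) (w t))" for t
  have m: "m t > 0" if "t > b" for t
    using ww[OF that] xw[OF that] by (simp add: m_def divide_neg_pos mult_pos_neg)
  have fm: "f t = x + m t *\<^sub>R w t" for t
    by (simp add: f_def m_def reflect_def)
  \<comment> \<open>Both vectors satisfy \<open>mink p p = - 2 * mink x p\<close>, and a multiple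
    \<open>l *\<^sub>R p\<close> does so only for \<open>l = 0\<close> or \<open>l = 1\<close>, that
    is \<open>z = x\<close> or \<open>z = y\<close>.\<close>
  have noncollinear: "q \<noteq> l *\<^sub>R p" for l
  proof
    assume q: "q = l *\<^sub>R p"
    have "l * l * mink p p = l * mink p p"
      using pp unfolding q by (simp add: mink_scale_left mink_scale_right mult.assoc)
    moreover have "mink p p \<noteq> 0"
      using xp pp by linarith
    ultimately have "l = 0 \<or> l = 1"
      by simp
    then show False
      using q assms by (auto simp: p_def q_def)
  qed
  have "inj_on f {b<..}"
  proof (rule inj_onI)
    fix t t' assume tt: "t \<in> {b<..}" "t' \<in> {b<..}" and "f t = f t'"
    then have eq: "m t *\<^sub>R w t = m t' *\<^sub>R w t'"
      by (simp add: fm)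
    then have eq': "(m t - m t') *\<^sub>R q = (m t' * t' - m t * t) *\<^sub>R p"
      by (simp add: w_def algebra_simps)
    have "m t = m t'"
    proof (rule ccontr)
      assume "m t \<noteq> m t'"
      then have "q = (1 / (m t - m t')) *\<^sub>R ((m t - m t') *\<^sub>R q)"
        by simp
      then show False
        unfolding eq' using noncollinear by simp
    qed
    then have "w t = w t'"
      using eq m[of t'] tt by simp
    then show "t = t'"
      using p0 by (simp add: w_def)
  qed
  moreover have "f ` {b<..} \<subseteq> \<Sigma>"
    using f\<Sigma> by auto
  ultimately show ?thesis
    using finite_subset finite_imageD infinite_Ioi by metis
qed

section \<open>Back from the vectors in \<Sigma> to their spheres\<close>

lemma uminus_\<Sigma>: "a \<in> \<Sigma> \<Longrightarrow> b \<in> \<Sigma> \<Longrightarrow> a \<noteq> - b"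
  using \<Sigma>_mink(2)[OF _ pair(1), of a] \<Sigma>_mink(2)[OF _ pair(1), of b] by (auto simp: mink_linear)

lemma inj_on_sphere_of: "inj_on sphere_of \<Sigma>"
  by (rule inj_onI) (metis sphere_of_eq_iff \<Sigma>_between between_def uminus_\<Sigma>)

lemma tangent_\<Sigma>_iff:
  assumes "a \<in> \<Sigma>" "b \<in> \<Sigma>"
  shows "tangent (sphere_of a) (sphere_of b) \<longleftrightarrow> mink a b = - 1"
proof -
  have "unit a" "unit b"
    using assms by (auto simp: \<Sigma>_def)
  moreover have "mink a b < 1 \<or> a = b" "a \<noteq> - b" "mink a b = - 1 \<Longrightarrow> a \<noteq> b"
    using \<Sigma>_mink_less[OF assms] uminus_\<Sigma>[OF assms] \<Sigma>_mink(1)[OF assms(1)] by auto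
  ultimately show ?thesis
    using tangent_iff[of a b] by auto
qed

text \<open>The Gram matrix of a clique has 1 on the diagonal and -1 elsewhere, so any two
  enumerated cliques of equal size satisfy the hypotheses of
  \<open>isometry_extends\<close>.\<close>

lemma transport:
  assumes K: "K \<subseteq> sphere_of ` \<Sigma>" "finite K" "\<And>C D. C \<in> K \<Longrightarrow> D \<in> K \<Longrightarrow> C \<noteq> D \<Longrightarrow> tangent C D"
    and L: "L \<subseteq> sphere_of ` \<Sigma>" "finite L" "\<And>C D. C \<in> L \<Longrightarrow> D \<in> L \<Longrightarrow> C \<noteq> D \<Longrightarrow> tangent C D"
    and "card K = card L" "CARD('a) \<ge> 2"
  obtains G where "bij_betw G (sphere_of ` \<Sigma>) (sphere_of ` \<Sigma>)" "G ` K = L"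
    "\<And>C D. C \<in> sphere_of ` \<Sigma> \<Longrightarrow> D \<in> sphere_of ` \<Sigma> \<Longrightarrow> tangent (G C) (G D) \<longleftrightarrow> tangent C D"
    "\<And>C D. C \<in> sphere_of ` \<Sigma> \<Longrightarrow> D \<in> sphere_of ` \<Sigma> \<Longrightarrow> nonintersecting C D \<Longrightarrow> nonintersecting (G C) (G D)"
proof -
  let ?v = "inv_into \<Sigma> sphere_of"
  have v: "?v C \<in> \<Sigma>" "sphere_of (?v C) = C" if "C \<in> sphere_of ` \<Sigma>" for C
    using that by (auto simp: inv_into_into f_inv_into_f)
  have vZ: "?v (sphere_of a) = a" if "a \<in> \<Sigma>" for a
    using that by (simp add: inv_into_f_f[OF inj_on_sphere_of])
  define N where "N = card K"
  obtain h where h: "bij_betw h {0..<N} K"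
    using ex_bij_betw_nat_finite[OF K(2)] unfolding N_def by blast
  obtain g where g: "bij_betw g {0..<N} L"
    using ex_bij_betw_nat_finite[OF L(2)] assms(7) unfolding N_def by auto
  have gram: "mink (?v (f i)) (?v (f j)) = (if i = j then 1 else - 1)"
    if "bij_betw f {0..<N} M" "M \<subseteq> sphere_of ` \<Sigma>" "i < N" "j < N"
      "\<And>C D. C \<in> M \<Longrightarrow> D \<in> M \<Longrightarrow> C \<noteq> D \<Longrightarrow> tangent C D" for f M i j
  proof (cases "i = j")
    case True
    then show ?thesis
      using \<Sigma>_mink(1)[OF v(1)] that(2,4) bij_betwE[OF that(1)] by (simp add: subset_iff)
  next
    case False
    have M: "f i \<in> M" "f j \<in> M"
      using that(3,4) bij_betwE[OF that(1)] by auto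
    moreover have "f i \<noteq> f j"
      using False that(3,4) inj_onD[OF bij_betw_imp_inj_on[OF that(1)], of i j] by auto
    ultimately have "tangent (f i) (f j)"
      by (rule that(5))
    then have "tangent (sphere_of (?v (f i))) (sphere_of (?v (f j)))"
      using M that(2) v(2) by (simp add: subset_iff)
    then show ?thesis
      using tangent_\<Sigma>_iff[OF v(1) v(1), of "f i" "f j"] M that(2) False by (simp add: subset_iff)
  qed
  have "\<exists>T. isometry T \<and> (\<forall>i<N. T (?v (h i)) = ?v (g i))"
  proof (rule isometry_extends)
    fix i j assume "i < N" "j < N"
    then show "mink (?v (h i)) (?v (h j)) = mink (?v (g i)) (?v (g j))"
      using gram[OF h K(1) _ _ K(3)] gram[OF g L(1) _ _ L(3)] by simp
  next
    fix i assume "i < N"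
    then show "?v (h i) \<in> \<Sigma>" "?v (g i) \<in> \<Sigma>"
      using bij_betwE[OF h] bij_betwE[OF g] K(1) L(1) v(1) by (auto simp: subset_iff)
  qed
  then obtain T where T: "isometry T" "\<And>i. i < N \<Longrightarrow> T (?v (h i)) = ?v (g i)"
    by blast
  have Tb: "bij_betw T \<Sigma> \<Sigma>" and Tlf: "\<And>a b. a \<in> \<Sigma> \<Longrightarrow> b \<in> \<Sigma> \<Longrightarrow> mink (T a) (T b) = mink a b"
    using T(1) unfolding isometry_def by auto
  have T\<Sigma>: "T a \<in> \<Sigma>" if "a \<in> \<Sigma>" for a
    using bij_betwE[OF Tb] that by blast
  define G where "G = sphere_of \<circ> T \<circ> ?v"
  have Zb: "bij_betw sphere_of \<Sigma> (sphere_of ` \<Sigma>)"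
    using inj_on_sphere_of by (simp add: bij_betw_def)
  have GZ: "G (sphere_of a) = sphere_of (T a)" if "a \<in> \<Sigma>" for a
    using that by (simp add: G_def vZ)
  have "bij_betw G (sphere_of ` \<Sigma>) (sphere_of ` \<Sigma>)"
    unfolding G_def comp_assoc
    using bij_betw_trans[OF bij_betw_trans[OF bij_betw_inv_into[OF Zb] Tb] Zb] by (simp add: comp_assoc)
  moreover have "G (h i) = g i" if "i < N" for i
  proof -
    have "g i \<in> sphere_of ` \<Sigma>"
      using bij_betwE[OF g] that L(1) by auto
    then show ?thesis
      using T(2)[OF that] v(2) by (simp add: G_def)
  qed
  then have "G ` h ` {0..<N} = g ` {0..<N}"
    by (auto simp: image_image)
  then have "G ` K = L"
    using h g by (simp add: bij_betw_def)
  moreover have "tangent (G C) (G D) \<longleftrightarrow> tangent C D" if "C \<in> sphere_of ` \<Sigma>" "D \<in> sphere_of ` \<Sigma>" for C D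
    using that by (auto simp: GZ tangent_\<Sigma>_iff T\<Sigma> Tlf)
  moreover have "nonintersecting (G C) (G D)"
    if CD: "C \<in> sphere_of ` \<Sigma>" "D \<in> sphere_of ` \<Sigma>" "nonintersecting C D" for C D
  proof -
    obtain a b where ab: "a \<in> \<Sigma>" "C = sphere_of a" "b \<in> \<Sigma>" "D = sphere_of b"
      using CD by blast
    have u: "unit a" "unit b" "unit (T a)" "unit (T b)"
      using ab T\<Sigma> by (auto simp: \<Sigma>_def)
    have "\<bar>mink a b\<bar> \<ge> 1"
      using nonintersecting_imp u CD(3) ab assms(8) by blast
    moreover have "a \<noteq> b"
      using ab CD(3) by (auto simp: nonintersecting_def)
    then have "T a \<noteq> T b"
      using Tb ab by (auto simp: bij_betw_def inj_on_def)
    ultimately show ?thesis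
      using nonintersectingI[OF u(3,4)] Tlf ab uminus_\<Sigma> T\<Sigma> by (simp add: GZ)
  qed
  ultimately show ?thesis
    using that by blast
qed

end

section \<open>Common orientations of a kissing family\<close>

text \<open>Here \<open>T\<close> holds one orientation of each member. The condition
  \<open>separated\<close> expresses the restriction on intersections with the first two spheres,
  \<open>not_pencil\<close> what the finiteness clause provides.\<close>

locale kissing_family = sphere_pair s1 s2 for s1 s2 :: "'n::finite lvec" +
  fixes T :: "'n lvec set"
  assumes pair: "s1 \<in> T" "s2 \<in> T"
    and unit_T: "t \<in> T \<Longrightarrow> unit t"
    and separated: "t \<in> T \<Longrightarrow> \<bar>mink t s1\<bar> \<ge> 1 \<or> \<bar>mink t s2\<bar> \<ge> 1"
    and not_pencil: "future_null (s1 + s2) \<Longrightarrow> \<exists>t\<in>T. \<not> in_pencil t"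
begin

definition kissing :: "'n lvec \<Rightarrow> bool" where
  "kissing c \<longleftrightarrow> unit c \<and> (\<forall>t\<in>T. kiss c t \<or> kiss c (- t))"

lemma kisses_iff: "kisses (sphere_of ` T) C \<longleftrightarrow> (\<exists>c. kissing c \<and> C = sphere_of c)"
proof
  assume C: "kisses (sphere_of ` T) C"
  have "gsphere S" if "S \<in> sphere_of ` T" for S
    using that unit_T gsphere_iff by blast
  then obtain c where c: "unit c" "C = sphere_of c" "\<And>S. S \<in> sphere_of ` T \<Longrightarrow> \<exists>s. unit s \<and> S = sphere_of s \<and> kiss c s"
    using kissesE[OF C] by metis
  have "kiss c t \<or> kiss c (- t)" if t: "t \<in> T" for t
  proof -
    obtain s where "unit s" "sphere_of t = sphere_of s" "kiss c s"
      using c(3)[of "sphere_of t"] t by blast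
    then show ?thesis
      using sphere_of_eq_iff unit_T[OF t] by blast
  qed
  then show "\<exists>c. kissing c \<and> C = sphere_of c"
    using c unfolding kissing_def by blast
next
  assume "\<exists>c. kissing c \<and> C = sphere_of c"
  then obtain c where c: "kissing c" "C = sphere_of c" by blast
  have "\<exists>s. unit s \<and> S = sphere_of s \<and> kiss c s" if "S \<in> sphere_of ` T" for S
    using that c(1) unit_T sphere_of_minus unit_minus unfolding kissing_def by blast
  then show "kisses (sphere_of ` T) C"
    using kissesI c unfolding kissing_def by blast
qed

text \<open>An exotic \<open>c\<close> has product below -1 with every sphere between the pair, and
  a member outside the pencil leaves no second exotic sphere to touch.\<close>

lemma tangent_imp_between:
  assumes "kissing c" "kissing d" "tangent (sphere_of c) (sphere_of d)"
  shows "between c"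
proof (rule ccontr)
  assume nb: "\<not> between c"
  have u: "unit c" "unit d"
    using assms by (auto simp: kissing_def)
  have tan: "\<bar>mink c d\<bar> = 1" "c \<noteq> d"
    using tangent_iff[OF u] assms(3) by auto
  obtain \<mu> where n: "future_null \<nu>" and \<mu>: "\<mu> > 0" "c = s1 + \<mu> *\<^sub>R \<nu> \<or> c = s2 + \<mu> *\<^sub>R \<nu>"
    using kiss_cases[OF u(1)] nb assms(1) pair unfolding kissing_def by blast
  consider "between d" | \<mu>' where "\<mu>' > 0" "d = s1 + \<mu>' *\<^sub>R \<nu> \<or> d = s2 + \<mu>' *\<^sub>R \<nu>"
    using kiss_cases[OF u(2)] assms(2) pair unfolding kissing_def by blast
  then show False
  proof cases
    case 1
    then show False
      using between_pencil_mink[OF n 1 \<mu>] tan(1) by (simp add: mink_commute)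
  next
    case 2
    obtain t where t: "t \<in> T" "\<not> in_pencil t"
      using not_pencil[OF n] by blast
    have t': "\<not> in_pencil (- t)" "\<bar>mink (- t) s1\<bar> \<ge> 1 \<or> \<bar>mink (- t) s2\<bar> \<ge> 1"
      using t(2) separated[OF t(1)] by (auto simp: in_pencil_def mink_linear)
    have d: "kiss d t \<or> kiss d (- t)" "kiss d (- t) \<or> kiss d (- (- t))"
      using assms(2) t(1) unfolding kissing_def by auto
    have "kiss c t \<or> kiss c (- t)"
      using assms(1) t(1) unfolding kissing_def by blast
    then have "d = c"
      using pencil_kiss_unique[OF n t(2) separated[OF t(1)] \<mu> _ 2 d(1)]
        pencil_kiss_unique[OF n t' \<mu> _ 2 d(2)] by blast
    then show False
      using tan by simp
  qed
qed

text \<open>If \<open>c\<close> and \<open>c'\<close> saw opposite orientations,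
  \<open>isolated\<close> would make one of them miss all kissing spheres between the pair, its
  tangent partner included.\<close>

lemma same_orientation:
  assumes "kissing c" "kissing d" "tangent (sphere_of c) (sphere_of d)" "kissing c'" "kissing d'" "tangent (sphere_of c') (sphere_of d')"
    and t: "t \<in> T \<or> - t \<in> T" "kiss c t"
  shows "kiss c' t"
proof (rule ccontr)
  assume "\<not> kiss c' t"
  have kiss: "kiss z t \<or> kiss z (- t)" if "kissing z" for z
    using that t(1) unfolding kissing_def by force
  then have c': "kiss c' (- t)"
    using \<open>\<not> kiss c' t\<close> assms(4) by blast
  have sep: "\<bar>mink t s1\<bar> \<ge> 1 \<or> \<bar>mink t s2\<bar> \<ge> 1"
    using t(1) separated[of t] separated[of "- t"] by (auto simp: mink_linear)
  have swap: "tangent (sphere_of d) (sphere_of c)" "tangent (sphere_of d') (sphere_of c')"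
    using assms(3,6) by (simp_all add: tangent_def inf_commute)
  have b: "between c" "between d" "between c'" "between d'"
    using tangent_imp_between assms(1-6) swap by blast+
  have ne: "\<bar>mink c d\<bar> = 1" "d \<noteq> c" "\<bar>mink c' d'\<bar> = 1" "d' \<noteq> c'"
    using tangent_iff assms(1-6) unfolding kissing_def by metis+
  obtain w where w: "w = c \<or> w = c'"
    "\<And>z. between z \<Longrightarrow> kiss z t \<or> kiss z (- t) \<Longrightarrow> z \<noteq> w \<Longrightarrow> mink w z < - 1"
    using isolated[OF b(1,3) t(2) c' sep] by blast
  from w(1) show False
    using w(2)[OF b(2) kiss[OF assms(2)]] w(2)[OF b(4) kiss[OF assms(5)]] ne by auto
qed

lemma oriented_family_exists:
  assumes "kissing c0" "kissing d0" "tangent (sphere_of c0) (sphere_of d0)"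
  obtains A where "oriented_family s1 s2 A"
    "\<And>c. c \<in> oriented_family.\<Sigma> A \<Longrightarrow> kissing c"
    "\<And>c d. kissing c \<Longrightarrow> kissing d \<Longrightarrow> tangent (sphere_of c) (sphere_of d) \<Longrightarrow> c \<in> oriented_family.\<Sigma> A"
proof -
  define A where "A = {t. (t \<in> T \<or> - t \<in> T) \<and> kiss c0 t}"
  have "between c0"
    using tangent_imp_between assms by blast
  then have "s1 \<in> A" "s2 \<in> A"
    using pair by (auto simp: A_def between_def)
  then interpret oriented_family s1 s2 A
    by unfold_locales
  have "kissing c" if "c \<in> \<Sigma>" for c
  proof -
    have "kiss c t \<or> kiss c (- t)" if "t \<in> T" for t
    proof -
      have "t \<in> A \<or> - t \<in> A"
        using assms(1) that by (auto simp: A_def kissing_def)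
      then show ?thesis
        using \<open>c \<in> \<Sigma>\<close> by (auto simp: \<Sigma>_def)
    qed
    then show ?thesis
      using that by (simp add: kissing_def \<Sigma>_def)
  qed
  moreover have "c \<in> \<Sigma>" if "kissing c" "kissing d" "tangent (sphere_of c) (sphere_of d)" for c d
    using same_orientation[OF assms that] that(1) unfolding \<Sigma>_def by (simp add: A_def kissing_def)
  ultimately show ?thesis
    using that oriented_family_axioms by blast
qed

end

section \<open>Steiner and tight arrangements\<close>

lemma tangent_sym: "tangent C D \<Longrightarrow> tangent D C"
  by (simp add: tangent_def inf_commute)

lemma tight_process_start:
  assumes "tight_process d F \<C>\<^sub>0 k \<C>"
  shows "clique F (d - 1) \<C>\<^sub>0" "\<exists>X. adjacent F \<C>\<^sub>0 X" "\<C>\<^sub>0 \<subseteq> \<C>" "\<C> \<noteq> {}" "\<forall>C\<in>\<C>. kisses F C"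
  using assms by (induction; auto simp: clique_def adjacent_def)+

text \<open>For \<open>d \<ge> 2\<close> the initial clique is non-empty, so the first added sphere
  has a tangent partner; for \<open>d = 1\<close> the first step yields a lone sphere.\<close>

lemma tight_process_kissing:
  assumes "tight_process d F \<C>\<^sub>0 k \<C>" "d \<ge> 2"
  shows "kissing_arrangement F \<C>"
  using assms(1)
proof cases
  case (first X)
  have kisses: "\<forall>C\<in>insert X \<C>\<^sub>0. kisses F C"
    using first by (auto simp: clique_def adjacent_def)
  have tan: "tangent C D" if "C \<in> insert X \<C>\<^sub>0" "D \<in> insert X \<C>\<^sub>0" "C \<noteq> D" for C D
    using first that tangent_sym[of D C] unfolding clique_def adjacent_def by auto
  have "\<exists>E\<in>insert X \<C>\<^sub>0. tangent C E" if "C \<in> insert X \<C>\<^sub>0" for C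
  proof -
    obtain E where "E \<in> \<C>\<^sub>0"
      using first assms(2) unfolding clique_def by (metis card.empty ex_in_conv not_less_eq_eq numeral_2_eq_2 One_nat_def diff_is_0_eq)
    then show ?thesis
      using first that tangent_sym[of X C] unfolding adjacent_def by auto
  qed
  then show ?thesis
    using kisses tan unfolding first(2) kissing_arrangement_def nonintersecting_def by blast
next
  case step
  then show ?thesis by blast
qed

lemma tight_imp_steiner:
  assumes d: "d \<ge> 2" and st: "steiner d F \<C>" and tight: "tight d F \<T>"
    and kisses: "\<And>C. C \<in> \<Omega> \<Longrightarrow> kisses F C"
    and \<Omega>: "\<And>C D. kisses F C \<Longrightarrow> kisses F D \<Longrightarrow> tangent C D \<Longrightarrow> C \<in> \<Omega>"
    and transport: "\<And>K L. K \<subseteq> \<Omega> \<Longrightarrow> L \<subseteq> \<Omega> \<Longrightarrow> clique F (d - 1) K \<Longrightarrow> clique F (d - 1) L \<Longrightarrow>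
      \<exists>G. bij_betw G \<Omega> \<Omega> \<and> G ` K = L \<and> (\<forall>C\<in>\<Omega>. \<forall>D\<in>\<Omega>. tangent (G C) (G D) \<longleftrightarrow> tangent C D) \<and>
        (\<forall>C\<in>\<Omega>. \<forall>D\<in>\<Omega>. nonintersecting C D \<longrightarrow> nonintersecting (G C) (G D))"
  shows "steiner d F \<T>"
proof -
  obtain \<C>\<^sub>0 t where T: "tight_process d F \<C>\<^sub>0 t \<T>" "\<And>k \<D>. tight_process d F \<C>\<^sub>0 k \<D> \<Longrightarrow> k \<le> t"
    using tight by (auto simp: tight_def)
  have arr: "kissing_arrangement F \<C>" and closed: "\<And>K X. K \<subseteq> \<C> \<Longrightarrow> clique F (d - 1) K \<Longrightarrow> adjacent F K X \<Longrightarrow> X \<in> \<C>"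
    using st by (auto simp: steiner_def)
  obtain K where K: "K \<subseteq> \<C>" "clique F (d - 1) K"
    using st by (auto simp: steiner_def)
  have C\<Omega>: "\<C> \<subseteq> \<Omega>"
  proof
    fix C assume "C \<in> \<C>"
    then obtain D where "D \<in> \<C>" "tangent C D" "kisses F C" "kisses F D"
      using arr unfolding kissing_arrangement_def by meson
    then show "C \<in> \<Omega>"
      using \<Omega> by blast
  qed
  obtain X0 where X0: "adjacent F \<C>\<^sub>0 X0"
    using tight_process_start[OF T(1)] by blast
  have C0: "clique F (d - 1) \<C>\<^sub>0" "\<C>\<^sub>0 \<subseteq> \<T>"
    using tight_process_start[OF T(1)] by auto
  have C0\<Omega>: "\<C>\<^sub>0 \<subseteq> \<Omega>"
  proof
    fix C assume "C \<in> \<C>\<^sub>0"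
    then show "C \<in> \<Omega>"
      using X0 C0(1) \<Omega>[of C X0] tangent_sym[of X0 C] unfolding adjacent_def clique_def by simp
  qed
  obtain G where G: "bij_betw G \<Omega> \<Omega>" "G ` K = \<C>\<^sub>0"
    "\<And>C D. C \<in> \<Omega> \<Longrightarrow> D \<in> \<Omega> \<Longrightarrow> tangent (G C) (G D) \<longleftrightarrow> tangent C D"
    "\<And>C D. C \<in> \<Omega> \<Longrightarrow> D \<in> \<Omega> \<Longrightarrow> nonintersecting C D \<Longrightarrow> nonintersecting (G C) (G D)"
    using transport[OF subset_trans[OF K(1) C\<Omega>] C0\<Omega> K(2) C0(1)]
    by (elim exE conjE) (erule (1) that; blast)
  have inj: "inj_on G \<Omega>" and surj: "G ` \<Omega> = \<Omega>"
    using G(1) by (auto simp: bij_betw_def)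
  \<comment> \<open>The image inherits closure under adjacency and pairwise non-intersection; since
    it contains \<open>\<C>\<^sub>0\<close>, it traps the whole process.\<close>
  define \<D> where "\<D> = G ` \<C>"
  have D\<Omega>: "\<D> \<subseteq> \<Omega>"
    using C\<Omega> surj by (auto simp: \<D>_def)
  have Dclosed: "X \<in> \<D>" if L: "L \<subseteq> \<D>" "clique F (d - 1) L" "adjacent F L X" for L X
  proof -
    have "L \<noteq> {}"
      using L(2) d by (auto simp: clique_def)
    then obtain E where "E \<in> L" by blast
    then have "X \<in> \<Omega>"
      using L(2,3) \<Omega>[of X E] unfolding adjacent_def clique_def by simp
    then obtain X' where X': "X' \<in> \<Omega>" "X = G X'"
      using surj by blast
    define L' where "L' = {C \<in> \<C>. G C \<in> L}"
    have L': "L' \<subseteq> \<C>" "L' \<subseteq> \<Omega>" "G ` L' = L"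
      using L(1) C\<Omega> by (auto simp: L'_def \<D>_def)
    have injL: "inj_on G L'"
      using inj L'(2) inj_on_subset by blast
    have "clique F (d - 1) L'"
      unfolding clique_def
    proof (intro conjI ballI impI)
      show "finite L'"
        using finite_image_iff[OF injL] L'(3) L(2) unfolding clique_def by simp
      show "card L' = d - 1"
        using card_image[OF injL] L'(3) L(2) unfolding clique_def by simp
      fix C assume C: "C \<in> L'"
      then show "kisses F C"
        using L'(2) kisses by blast
      fix D assume D: "D \<in> L'" "C \<noteq> D"
      have "G C \<noteq> G D" "G C \<in> L" "G D \<in> L"
        using injL C D L'(3) unfolding inj_on_def by auto
      then have "tangent (G C) (G D)"
        using L(2) unfolding clique_def by blast
      then show "tangent C D"
        using G(3) C D L'(2) by blast
    qed
    moreover have "adjacent F L' X'"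
      unfolding adjacent_def
    proof (intro conjI ballI)
      show "kisses F X'"
        using kisses X' by blast
      fix C assume C: "C \<in> L'"
      then have "tangent X (G C)"
        using L(3) L'(3) unfolding adjacent_def by blast
      then show "tangent X' C"
        using G(3) X' C L'(2) by blast
    qed
    ultimately have "X' \<in> \<C>"
      using closed L'(1) by blast
    then show ?thesis
      using X' by (simp add: \<D>_def)
  qed
  have inD: "\<U> \<subseteq> \<D>" if "tight_process d F \<C>\<^sub>0 k \<U>" for k \<U>
    using that
  proof induction
    case (first X)
    have "\<C>\<^sub>0 \<subseteq> \<D>"
      using G(2) K(1) by (auto simp: \<D>_def)
    then show ?case
      using Dclosed first by blast
  next
    case (step k \<U> K X)
    then show ?case
      using Dclosed[of K X] by blast
  qed
  have Darr: "nonintersecting C D" if "C \<in> \<D>" "D \<in> \<D>" "C \<noteq> D" for C D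
  proof -
    obtain C' D' where CD: "C' \<in> \<C>" "C = G C'" "D' \<in> \<C>" "D = G D'"
      using \<open>C \<in> \<D>\<close> \<open>D \<in> \<D>\<close> unfolding \<D>_def by blast
    then have "nonintersecting C' D'"
      using arr \<open>C \<noteq> D\<close> unfolding kissing_arrangement_def by metis
    then show ?thesis
      using G(4) CD C\<Omega> by (simp add: subset_iff)
  qed
  have Tarr: "kissing_arrangement F \<T>"
    using tight_process_kissing[OF T(1) d] .
  \<comment> \<open>A missing \<open>X\<close> lies in \<open>\<D>\<close> together with
    \<open>\<T>\<close>, so it could be added, giving a process of \<open>t + 1\<close>
    steps.\<close>
  have "X \<in> \<T>" if L: "L \<subseteq> \<T>" "clique F (d - 1) L" "adjacent F L X" for L X
  proof (rule ccontr)
    assume X: "X \<notin> \<T>"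
    have "L \<noteq> {}"
      using L(2) d by (auto simp: clique_def)
    then obtain E where E: "E \<in> L" by blast
    have "X \<in> \<D>" "\<T> \<subseteq> \<D>"
      using Dclosed[OF _ L(2,3)] L(1) inD[OF T(1)] by auto
    then have "\<forall>C\<in>insert X \<T>. \<forall>D\<in>insert X \<T>. C \<noteq> D \<longrightarrow> nonintersecting C D"
      using Darr by (meson insert_subset subsetD)
    moreover have X: "kisses F X" "tangent X E" "E \<in> \<T>" and XT: "X \<notin> \<T>"
      using L(1,3) E X unfolding adjacent_def by auto
    moreover have "\<forall>C\<in>insert X \<T>. kisses F C" "\<forall>C\<in>insert X \<T>. \<exists>D\<in>insert X \<T>. tangent C D"
      using X Tarr unfolding kissing_arrangement_def by auto
    ultimately have "kissing_arrangement F (insert X \<T>)"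
      unfolding kissing_arrangement_def by (intro conjI)
    then show False
      using T(2)[OF tight_process.step[OF T(1) L XT]] by simp
  qed
  then show ?thesis
    using st Tarr C0 unfolding steiner_def by blast
qed

text \<open>Every kissing sphere is adjacent to the empty clique, so \<open>\<C>\<close> consists of
  all of them. By \<open>diam\<close> their tangency graph is connected, so a process that has
  missed a sphere can still be extended.\<close>

lemma tight_imp_steiner_1:
  assumes st: "steiner 1 F \<C>" and tight: "tight 1 F \<T>"
    and diam: "\<And>C D. kisses F C \<Longrightarrow> kisses F D \<Longrightarrow> C \<noteq> D \<Longrightarrow>
      tangent C D \<or> (\<exists>E. kisses F E \<and> tangent C E \<and> tangent E D)"
  shows "steiner 1 F \<T>"
proof -
  obtain \<C>\<^sub>0 t where T: "tight_process 1 F \<C>\<^sub>0 t \<T>" "\<And>k \<D>. tight_process 1 F \<C>\<^sub>0 k \<D> \<Longrightarrow> k \<le> t"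
    using tight by (auto simp: tight_def)
  have empty: "clique F (1 - 1) {}"
    by (simp add: clique_def)
  have arr: "kissing_arrangement F \<C>" and all: "kisses F C \<Longrightarrow> C \<in> \<C>" for C
    using st empty by (auto simp: steiner_def adjacent_def)
  have kT: "\<forall>C\<in>\<T>. kisses F C" "\<T> \<noteq> {}"
    using tight_process_start[OF T(1)] by auto
  have partner: "\<forall>C\<in>\<T>. (\<exists>D\<in>\<T>. tangent C D) \<or> \<T> = {C}"
    using T(1)
  proof cases
    case (first X)
    then show ?thesis by (auto simp: clique_def)
  next
    case step
    then show ?thesis unfolding kissing_arrangement_def by blast
  qed
  have "\<T> = \<C>"
  proof (rule ccontr)
    assume "\<T> \<noteq> \<C>"
    then obtain Y where Y: "Y \<in> \<C>" "Y \<notin> \<T>"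
      using kT all by blast
    obtain X where X: "X \<in> \<T>"
      using kT by blast
    have "kisses F Y"
      using Y arr by (auto simp: kissing_arrangement_def)
    \<comment> \<open>The edge by which a path of length at most two from \<open>X\<close> to
      \<open>Y\<close> leaves \<open>\<T>\<close>.\<close>
    then obtain U V where U: "kisses F U" "U \<notin> \<T>" "V \<in> \<T>" "tangent U V"
      using diam[of X Y] X Y kT tangent_sym by metis
    have "\<forall>C\<in>insert U \<T>. \<exists>D\<in>insert U \<T>. tangent C D"
    proof
      fix C assume "C \<in> insert U \<T>"
      then show "\<exists>D\<in>insert U \<T>. tangent C D"
        using partner U(3,4) tangent_sym[of U V] by (metis insert_iff singletonD)
    qed
    moreover have "insert U \<T> \<subseteq> \<C>"
      using all kT(1) U(1) by blast
    then have "\<forall>C\<in>insert U \<T>. \<forall>D\<in>insert U \<T>. C \<noteq> D \<longrightarrow> nonintersecting C D"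
      using arr unfolding kissing_arrangement_def by (meson subsetD)
    moreover have "\<forall>C\<in>insert U \<T>. kisses F C"
      using kT(1) U(1) by simp
    ultimately have "kissing_arrangement F (insert U \<T>)"
      unfolding kissing_arrangement_def by (intro conjI)
    moreover have "adjacent F {} U"
      using U(1) by (simp add: adjacent_def)
    ultimately show False
      using T(2)[OF tight_process.step[OF T(1) _ empty _ U(2)]] by simp
  qed
  then show ?thesis
    using st by simp
qed

section \<open>Two disjoint spheres on the line\<close>

lemma ext_inject: "ext C = ext D \<longleftrightarrow> C = D"
proof
  have "C = {x. Some x \<in> ext C}" for C :: "(real^'n) set"
    by (auto simp: ext_def)
  then show "C = D" if "ext C = ext D"
    using that by metis
qed simp

lemma card_ext:
  fixes C :: "(real^'n) set"
  assumes "CARD('n) = 1" "gsphere C"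
  shows "card (ext C) = 2"
proof -
  obtain i :: 'n where i: "UNIV = {i}"
    using assms(1) card_1_singletonE by blast
  then have all: "j = i" for j by auto
  have eq: "x = y \<longleftrightarrow> x $ i = y $ i" for x y :: "real^'n"
    using all by (metis vec_eq_iff)
  have norm: "norm x = \<bar>x $ i\<bar>" for x :: "real^'n"
    by (simp add: norm_vec_def L2_set_def i)
  have inner: "x \<bullet> y = x $ i * y $ i" for x y :: "real^'n"
    by (simp add: inner_vec_def i)
  from assms(2) consider a r where "r > 0" "C = sphere a r" | a b where "a \<noteq> 0" "C = {x. a \<bullet> x = b}"
    unfolding gsphere_def hyperplane_def by blast
  then show ?thesis
  proof cases
    case 1
    have "C = {vec (a $ i + r), vec (a $ i - r)}"
      unfolding 1(2) using 1(1) by (auto simp: dist_norm norm eq)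
    moreover have "ext C = Some ` C"
      using sphere_not_hyperplane[OF 1(1), of a] 1(2) by (simp add: ext_def)
    moreover have "vec (a $ i + r) \<noteq> (vec (a $ i - r) :: real^'n)"
      using 1(1) by (simp add: eq)
    ultimately show ?thesis
      by simp
  next
    case 2
    have "a $ i \<noteq> 0"
      using 2(1) by (simp add: eq)
    then have "C = {vec (b / a $ i)}"
      unfolding 2(2) by (auto simp: inner eq field_simps)
    moreover have "hyperplane C"
      using 2 by (auto simp: hyperplane_def)
    ultimately show ?thesis
      by (simp add: ext_def)
  qed
qed

text \<open>On the line, a sphere touching two disjoint spheres consists of one point of each.\<close>

lemma line_kissing_diameter:
  fixes S1 S2 :: "(real^'n) set"
  assumes n: "CARD('n) = 1" and S: "gsphere S1" "gsphere S2" and disj: "ext S1 \<inter> ext S2 = {}"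
    and C: "kisses {S1, S2} C" and D: "kisses {S1, S2} D" and "C \<noteq> D"
    and E: "kisses {S1, S2} E" "tangent C E"
  shows "tangent C D \<or> tangent E D"
proof -
  have *: "\<exists>x y. x \<in> ext S1 \<and> y \<in> ext S2 \<and> ext C = {x, y}" if C: "kisses {S1, S2} C" for C
  proof -
    obtain x y where xy: "ext C \<inter> ext S1 = {x}" "ext C \<inter> ext S2 = {y}"
      using C unfolding kisses_def tangent_def by auto
    have "card (ext C) = 2"
      using C card_ext[OF n] by (simp add: kisses_def)
    moreover have "x \<noteq> y" "{x, y} \<subseteq> ext C"
      using xy disj by auto
    ultimately have "ext C = {x, y}"
      using card_subset_eq[of "ext C" "{x, y}"] by (metis card_2_iff card.infinite zero_neq_numeral)
    then show ?thesis
      using xy by blast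
  qed
  obtain c c' where c: "c \<in> ext S1" "c' \<in> ext S2" "ext C = {c, c'}" using *[OF C] by blast
  obtain d d' where d: "d \<in> ext S1" "d' \<in> ext S2" "ext D = {d, d'}" using *[OF D] by blast
  obtain e e' where e: "e \<in> ext S1" "e' \<in> ext S2" "ext E = {e, e'}" using *[OF E(1)] by blast
  have S2: "x = y \<or> x = z \<or> y = z" if "x \<in> ext S" "y \<in> ext S" "z \<in> ext S" "gsphere S" for x y z and S :: "(real^'n) set"
    using card_ext[OF n that(4)] that(1-3) unfolding card_2_iff by auto
  have ne: "u \<noteq> v" if "u \<in> ext S1" "v \<in> ext S2" for u v
    using disj that by blast
  \<comment> \<open>A sphere is a choice of one point from each of \<open>S1\<close> and
    \<open>S2\<close>, and tangency means differing in exactly one choice. In this 4-cycle, every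
    neighbour of \<open>C\<close> is also a neighbour of the opposite sphere.\<close>
  have tan: "tangent A B \<longleftrightarrow> (a = b) \<noteq> (a' = b')"
    if "a \<in> ext S1" "b \<in> ext S1" "a' \<in> ext S2" "b' \<in> ext S2" "ext A = {a, a'}" "ext B = {b, b'}" for A B a b a' b'
    using ne[OF that(1,3)] ne[OF that(1,4)] ne[OF that(2,3)] ne[OF that(2,4)]
    unfolding tangent_def that(5,6) by (cases "a = b"; cases "a' = b'") auto
  have "\<not> (c = d \<and> c' = d')"
    using ext_inject[of C D] \<open>C \<noteq> D\<close> c d by auto
  then show ?thesis
    using tan[OF c(1) d(1) c(2) d(2) c(3) d(3)] tan[OF e(1) d(1) e(2) d(2) e(3) d(3)]
      tan[OF c(1) e(1) c(2) e(2) c(3) e(3)] E(2)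
      S2[OF c(1) d(1) e(1) S(1)] S2[OF c(2) d(2) e(2) S(2)] by blast
qed

section \<open>From an S-family to its vectors, and the conclusion\<close>

lemma S_family_vectors:
  fixes S :: "nat \<Rightarrow> (real^'n) set"
  assumes m: "2 \<le> m" "m < CARD('n) + 2" and gs: "\<forall>i\<in>{1..m}. gsphere (S i)" and fam: "S_family m S"
    and n: "tangent (S 1) (S 2) \<or> CARD('n) \<ge> 2"
  obtains s1 s2 T where "kissing_family s1 s2 T" "S ` {1..m} = sphere_of ` T"
proof -
  have "\<forall>i\<in>{1..m}. \<exists>u. unit u \<and> S i = sphere_of u"
    using gs gsphere_iff by blast
  from bchoice[OF this] obtain u where u: "\<forall>i\<in>{1..m}. unit (u i) \<and> S i = sphere_of (u i)"
    by blast
  have u12: "unit (u 1)" "unit (u 2)" "S 1 = sphere_of (u 1)" "S 2 = sphere_of (u 2)"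
    using u m by auto
  have non: "nonintersecting (sphere_of (u 1)) (sphere_of (u 2))"
    using fam u12 by (simp add: S_family_def)
  have ge: "\<bar>mink (u 1) (u 2)\<bar> \<ge> 1"
    using nonintersecting_imp[OF u12(1,2) non] n u12 by simp
  have ne: "u 1 \<noteq> u 2" "u 1 \<noteq> - u 2"
    using non by (auto simp: nonintersecting_def)
  define e where "e = (if mink (u 1) (u 2) > 0 then - u 2 else u 2)"
  have e: "unit e" "sphere_of e = S 2" "mink (u 1) e \<le> - 1" "u 1 + e \<noteq> 0"
    using u12 ge ne by (auto simp: e_def mink_linear add_eq_0_iff2)
  have "mink (u 1 + e) (u 1 + e) \<le> 0"
    using u12(1) e by (simp add: mink_linear unit_def mink_commute[of e "u (Suc 0)"])
  \<comment> \<open>In the second case both orientations are reversed, which keeps their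
    product.\<close>
  then consider "causal (u 1 + e)" | "causal (- u 1 + - e)"
    using causal_cases[OF _ e(4)] unfolding minus_add_distrib by blast
  then obtain s1 s2 where s: "unit s1" "unit s2" "S 1 = sphere_of s1" "S 2 = sphere_of s2" "causal (s1 + s2)"
    using u12 e by cases (metis, metis sphere_of_minus unit_minus)
  define t where "t i = (if i = 1 then s1 else if i = 2 then s2 else u i)" for i
  have t: "unit (t i)" "S i = sphere_of (t i)" if "i \<in> {1..m}" for i
    using u s that by (auto simp: t_def)
  interpret sphere_pair s1 s2
    using s by unfold_locales
  have "kissing_family s1 s2 (t ` {1..m})"
  proof unfold_locales
    have "t 1 = s1" "t 2 = s2"
      by (simp_all add: t_def)
    then show "s1 \<in> t ` {1..m}" "s2 \<in> t ` {1..m}"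
      using m by force+
  next
    fix v assume "v \<in> t ` {1..m}"
    then obtain i where i: "i \<in> {1..m}" "v = t i" by blast
    then show "unit v" using t by simp
    show "\<bar>mink v s1\<bar> \<ge> 1 \<or> \<bar>mink v s2\<bar> \<ge> 1"
    proof (cases "i \<ge> 3")
      case True
      \<comment> \<open>An index \<open>i \<ge> 3\<close> forces \<open>m \<ge> 3\<close> and hence
        \<open>CARD('n) \<ge> 2\<close>, where disjointness does bound the product.\<close>
      then have "nonintersecting (S i) (S 1) \<or> nonintersecting (S i) (S 2)" "CARD('n) \<ge> 2"
        using fam i m by (auto simp: S_family_def)
      then show ?thesis
        using nonintersecting_imp[OF t(1)[OF i(1)] s(1)] nonintersecting_imp[OF t(1)[OF i(1)] s(2)]
          s t(2)[OF i(1)] i(2) by simp blast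
    next
      case False
      then have "i = 1 \<or> i = 2"
        using i(1) by auto
      then show ?thesis
        using i(2) mink_pair by (auto simp: t_def)
    qed
  next
    assume "future_null (s1 + s2)"
    show "\<exists>v\<in>t ` {1..m}. \<not> in_pencil v"
    proof (rule ccontr)
      assume "\<not> ?thesis"
      then have "\<exists>v. R = sphere_of v \<and> in_pencil v" if "R \<in> S ` {1..m}" for R
        using that t(2) by (metis imageE imageI)
      then obtain \<C> where "kissing_arrangement (S ` {1..m}) \<C>" "infinite \<C>"
        using infinite_pencil_arrangement[OF \<open>future_null (s1 + s2)\<close>, of "S ` {1..m}"] by auto
      then show False
        using fam by (simp add: S_family_def)
    qed
  qed
  moreover have "S ` {1..m} = sphere_of ` t ` {1..m}"
    using t(2) by (auto simp: image_image)
  ultimately show ?thesis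
    by (rule that)
qed

lemma steiner_1_partner:
  assumes "steiner 1 F \<C>" "kisses F C"
  shows "C \<in> \<C>" "\<exists>E. kisses F E \<and> tangent C E"
proof -
  have "clique F (1 - 1) {}" "adjacent F {} C"
    using assms(2) by (simp_all add: clique_def adjacent_def)
  then show "C \<in> \<C>"
    using assms(1) unfolding steiner_def by (meson empty_subsetI)
  then show "\<exists>E. kisses F E \<and> tangent C E"
    using assms(1) unfolding steiner_def kissing_arrangement_def by meson
qed

theorem corollary3p6:
  fixes S :: "nat \<Rightarrow> (real^'n) set" and m d :: nat and F :: "(real^'n) set set"
  assumes "2 \<le> m" and "m < CARD('n) + 2"
    and "d = CARD('n) + 2 - m"
    and "F = S ` {1..m}"
    and "\<forall>i\<in>{1..m}. gsphere (S i)"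
    and "S_family m S"
    and "\<exists>\<C>. steiner d F \<C>"
  shows "\<forall>\<T>. tight d F \<T> \<longrightarrow> steiner d F \<T>"
proof (intro allI impI)
  fix \<T> assume tight: "tight d F \<T>"
  obtain \<C> where st: "steiner d F \<C>"
    using assms(7) by blast
  show "steiner d F \<T>"
  proof (cases "tangent (S 1) (S 2) \<or> CARD('n) \<ge> 2")
    \<comment> \<open>Interlaced spheres on the line admit no orientation with causal sum, so this
      case is treated outside the vector model.\<close>
    case False
    have n: "CARD('n) = 1"
      using False zero_less_card_finite[where 'a = 'n] by linarith
    then have m: "m = 2" and d: "d = 1"
      using assms(1-3) by auto
    have F: "F = {S 1, S 2}"
      unfolding assms(4) m by (auto simp: numeral_2_eq_2 atLeastAtMostSuc_conv)
    have disj: "ext (S 1) \<inter> ext (S 2) = {}"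
      using assms(6) False by (simp add: S_family_def nonintersecting_def)
    have gs: "gsphere (S 1)" "gsphere (S 2)"
      using assms(5) m by auto
    show ?thesis
      unfolding d
    proof (rule tight_imp_steiner_1)
      show st1: "steiner 1 F \<C>" and "tight 1 F \<T>"
        using st tight d by auto
      fix C D assume C: "kisses F C" and D: "kisses F D" and "C \<noteq> D"
      obtain E where "kisses F E" "tangent C E"
        using steiner_1_partner(2)[OF st1 C] by blast
      then show "tangent C D \<or> (\<exists>E. kisses F E \<and> tangent C E \<and> tangent E D)"
        using line_kissing_diameter[OF n gs disj C[unfolded F] D[unfolded F] \<open>C \<noteq> D\<close>] F by blast
    qed
  next
    case True
    obtain s1 s2 T where T: "kissing_family s1 s2 T" "S ` {1..m} = sphere_of ` T"
      using S_family_vectors[OF assms(1,2,5,6) True] by blast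
    have F: "F = sphere_of ` T"
      using T(2) assms(4) by simp
    interpret kissing_family s1 s2 T
      by (rule T(1))
    \<comment> \<open>A non-empty arrangement supplies the tangent pair whose orientations of the
      family define \<open>A\<close>.\<close>
    obtain \<B> where "\<B> \<noteq> {}" "kissing_arrangement F \<B>"
      using assms(4,6) by (auto simp: S_family_def)
    then obtain C0 D0 where "kisses F C0" "kisses F D0" "tangent C0 D0"
      unfolding kissing_arrangement_def by (meson ex_in_conv)
    then obtain c0 d0 where "kissing c0" "kissing d0" "tangent (sphere_of c0) (sphere_of d0)"
      unfolding F kisses_iff by blast
    then obtain A where A: "oriented_family s1 s2 A"
      "\<And>c. c \<in> oriented_family.\<Sigma> A \<Longrightarrow> kissing c"
      "\<And>c d. kissing c \<Longrightarrow> kissing d \<Longrightarrow> tangent (sphere_of c) (sphere_of d) \<Longrightarrow> c \<in> oriented_family.\<Sigma> A"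
      using oriented_family_exists by blast
    interpret A: oriented_family s1 s2 A
      by (rule A(1))
    let ?\<Omega> = "sphere_of ` A.\<Sigma>"
    have kisses: "kisses F C" if "C \<in> ?\<Omega>" for C
      using that A(2) unfolding F kisses_iff by blast
    have mem: "C \<in> ?\<Omega>" if "kisses F C" "kisses F D" "tangent C D" for C D
      using that A(3) unfolding F kisses_iff by blast
    show ?thesis
    proof (cases "d \<ge> 2")
      case True
      then have n: "CARD('n) \<ge> 2"
        using assms(1,3) by linarith
      show ?thesis
      proof (rule tight_imp_steiner[OF True st tight kisses mem])
        fix K L
        assume K: "K \<subseteq> ?\<Omega>" and L: "L \<subseteq> ?\<Omega>" and "clique F (d - 1) K" "clique F (d - 1) L"
        then have cK: "finite K" "\<And>C D. C \<in> K \<Longrightarrow> D \<in> K \<Longrightarrow> C \<noteq> D \<Longrightarrow> tangent C D"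
          and cL: "finite L" "\<And>C D. C \<in> L \<Longrightarrow> D \<in> L \<Longrightarrow> C \<noteq> D \<Longrightarrow> tangent C D"
          and card: "card K = card L"
          by (simp_all add: clique_def)
        show "\<exists>G. bij_betw G ?\<Omega> ?\<Omega> \<and> G ` K = L
            \<and> (\<forall>C\<in>?\<Omega>. \<forall>D\<in>?\<Omega>. tangent (G C) (G D) \<longleftrightarrow> tangent C D)
            \<and> (\<forall>C\<in>?\<Omega>. \<forall>D\<in>?\<Omega>. nonintersecting C D \<longrightarrow> nonintersecting (G C) (G D))"
          by (rule A.transport[OF K cK L cL card n]) (assumption | intro exI conjI ballI impI | blast)+
      qed
    next
      case False
      then have d: "d = 1"
        using assms(2,3) by linarith
      have st1: "steiner 1 F \<C>"
        using st d by simp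
      \<comment> \<open>For \<open>d = 1\<close> the Steiner arrangement contains every kissing
        sphere, so each has a tangent partner and none is exotic.\<close>
      have all: "C \<in> ?\<Omega>" if "kisses F C" for C
        using steiner_1_partner(2)[OF st1 that] mem[OF that] by blast
      have "?\<Omega> \<subseteq> \<C>"
        using steiner_1_partner(1)[OF st1] kisses by blast
      moreover have "finite \<C>"
        using st1 assms(4,6) unfolding steiner_def S_family_def by blast
      ultimately have fin: "finite A.\<Sigma>"
        using finite_subset finite_imageD[OF _ A.inj_on_sphere_of] by blast
      show ?thesis
        unfolding d
      proof (rule tight_imp_steiner_1[OF st1 tight[unfolded d]], rule disjI1, rule ccontr)
        fix C D assume CD: "kisses F C" "kisses F D" "C \<noteq> D" "\<not> tangent C D"
        obtain E where E: "kisses F E" "tangent C E"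
          using steiner_1_partner(2)[OF st1 CD(1)] by blast
        obtain x y z where xyz: "x \<in> A.\<Sigma>" "y \<in> A.\<Sigma>" "z \<in> A.\<Sigma>" "C = sphere_of x" "D = sphere_of y" "E = sphere_of z"
          using all[OF CD(1)] all[OF CD(2)] all[OF E(1)] by blast
        have "x \<noteq> y" "x \<noteq> z" "y \<noteq> z"
          using CD E xyz not_tangent_self[of x] by (auto simp: A.\<Sigma>_def)
        then show False
          using A.infinite_\<Sigma> xyz fin by blast
      qed
    qed
  qed
qed

end
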